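(* Let $G$ be a nonempty finite simple graph without isolated vertices, and let $n$ denote its number of minimal vertex covers. Then the following statements are equivalent. (1) The cover ideal $J(G)$ is Scarf. (2) $G$ is co-chordal and there are at least $n-1$ unordered pairs $\{V_1,V_2\}$ of distinct minimal vertex covers of $G$ such that the only minimal vertex covers of $G$ contained in $V_1\cup V_2$ are $V_1$ and $V_2$ themselves.
   Context: Let $\Bbbk$ be a field and $S=\Bbbk[V(G)]$ the polynomial ring whose variables are the vertices of $G$. A vertex cover of $G$ is a set of vertices meeting every edge. The cover ideal is $J(G)=\left(\prod_{x\in W}x : W\subseteq V(G)\text{ is a vertex cover of }G\right)\subseteq S$; its minimal monomial generators correspond to the minimal vertex covers. A graph is chordal if it has no induced cycle of length $\geq 4$, and co-chordal if its complement is chordal. Scarf ideals: for a monomial ideal $I$ let $\operatorname{Mingens}(I)$ be its set of minimal monomial generators. The Taylor resolution of $S/I$ has free basis $e_\sigma$, $\sigma\subseteq\operatorname{Mingens}(I)$, with $e_\sigma$ in homological degree $|\sigma|$ and $\partial(e_\sigma)=\sum_{j=1}^t(-1)^{j+1}\frac{\operatorname{lcm}(\sigma)}{\operatorname{lcm}(\sigma\setminus\{m_{i_j}\})}e_{\sigma\setminus\{m_{i_j}\}}$ for $\sigma=\{m_{i_1},\dots,m_{i_t}\}$. The Scarf complex of $I$ is the simplicial complex of all $\sigma\subseteq\operatorname{Mingens}(I)$ such that $\operatorname{lcm}(\sigma)\neq\operatorname{lcm}(\tau)$ for every $\tau\subseteq\operatorname{Mingens}(I)$ with $\tau\neq\sigma$.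 It induces a subcomplex of the Taylor resolution (spanned by the $e_\sigma$ with $\sigma$ in the Scarf complex). $I$ is called Scarf if this subcomplex is a minimal free resolution of $S/I$ (equivalently, a free resolution of $S/I$). *)

theory Defs
  imports Complex_Main "HOL-Library.Poly_Mapping"
begin

section \<open>Graphs\<close>

text \<open>
  A finite graph has the elements of a finite type as vertices and is given by its set of edges,
  each edge being a set of two vertices.
\<close>

definition simple_graph :: "'v set set \<Rightarrow> bool" where
  "simple_graph E \<longleftrightarrow> (\<forall>e\<in>E. card e = 2)"

definition no_isolated_vertices :: "'v set set \<Rightarrow> bool" where
  "no_isolated_vertices E \<longleftrightarrow> (\<forall>v. \<exists>e\<in>E. v \<in> e)"

definition complement_graph :: "'v set set \<Rightarrow> 'v set set" where
  "complement_graph E = {{u, v} | u v. u \<noteq> v \<and> {u, v} \<notin> E}"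

definition induced_cycle :: "'v set set \<Rightarrow> 'v list \<Rightarrow> bool" where
  "induced_cycle E xs \<longleftrightarrow> 3 \<le> length xs \<and> distinct xs \<and>
     (\<forall>i<length xs. \<forall>j<length xs.
        {xs ! i, xs ! j} \<in> E \<longleftrightarrow> j = Suc i mod length xs \<or> i = Suc j mod length xs)"

definition chordal :: "'v set set \<Rightarrow> bool" where
  "chordal E \<longleftrightarrow> \<not> (\<exists>xs. induced_cycle E xs \<and> 4 \<le> length xs)"

definition co_chordal :: "'v set set \<Rightarrow> bool" where
  "co_chordal E \<longleftrightarrow> chordal (complement_graph E)"

definition vertex_cover :: "'v set set \<Rightarrow> 'v set \<Rightarrow> bool" where
  "vertex_cover E W \<longleftrightarrow> (\<forall>e\<in>E. e \<inter> W \<noteq> {})"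

definition minimal_vertex_cover :: "'v set set \<Rightarrow> 'v set \<Rightarrow> bool" where
  "minimal_vertex_cover E W \<longleftrightarrow> vertex_cover E W \<and> (\<forall>U. U \<subset> W \<longrightarrow> \<not> vertex_cover E U)"


section \<open>Polynomials and monomial ideals\<close>

text \<open>
  The polynomial ring over \<open>'k\<close> with variables the elements of \<open>'v\<close>: finitely supported
  functions from exponent vectors to coefficients, with the convolution product.
\<close>

type_synonym 'v monom = "'v \<Rightarrow>\<^sub>0 nat"
type_synonym ('v, 'k) mpoly = "'v monom \<Rightarrow>\<^sub>0 'k"

definition mono_poly :: "'v monom \<Rightarrow> ('v, 'k::field) mpoly" where
  "mono_poly t = Poly_Mapping.single t 1"

definition Var :: "'v \<Rightarrow> ('v, 'k::field) mpoly" where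
  "Var x = mono_poly (Poly_Mapping.single x 1)"

definition ideal_gen :: "'a::comm_ring_1 set \<Rightarrow> 'a set" where
  "ideal_gen A = module.span (*) A"

definition cover_ideal :: "'v::finite set set \<Rightarrow> ('v, 'k::field) mpoly set" where
  "cover_ideal E = ideal_gen {\<Prod>x\<in>W. Var x | W. vertex_cover E W}"

text \<open>The order on \<^typ>\<open>'v monom\<close> provided by the library is not divisibility.\<close>

definition mdvd :: "'v monom \<Rightarrow> 'v monom \<Rightarrow> bool" where
  "mdvd s t \<longleftrightarrow> (\<forall>v. Poly_Mapping.lookup s v \<le> Poly_Mapping.lookup t v)"

definition mlcm :: "'v::finite monom set \<Rightarrow> 'v monom" where
  "mlcm \<sigma> = Abs_poly_mapping (\<lambda>v. Max (insert 0 ((\<lambda>t. Poly_Mapping.lookup t v) ` \<sigma>)))"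

text \<open>
  The divisibility-minimal monomials of \<open>I\<close>; by \<open>mingens_generate\<close> and \<open>mingens_least\<close> below
  this is the unique minimal set of monomial generators of a monomial ideal.
\<close>

definition mingens :: "('v, 'k::field) mpoly set \<Rightarrow> 'v monom set" where
  "mingens I = {t. mono_poly t \<in> I \<and> (\<forall>s. mono_poly s \<in> I \<and> mdvd s t \<longrightarrow> s = t)}"


section \<open>Free resolutions\<close>

text \<open>
  The free module over a ring \<open>'a\<close> on the basis \<open>'b\<close> is \<^typ>\<open>'b \<Rightarrow>\<^sub>0 'a\<close>, with basis elements
  \<open>Poly_Mapping.single b 1\<close>; \<open>free_on B\<close> is its free submodule on \<open>B\<close>.
\<close>

definition scal :: "'a::comm_ring_1 \<Rightarrow> ('b \<Rightarrow>\<^sub>0 'a) \<Rightarrow> ('b \<Rightarrow>\<^sub>0 'a)" where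
  "scal p c = Poly_Mapping.map ((*) p) c"

definition free_on :: "'b set \<Rightarrow> ('b \<Rightarrow>\<^sub>0 'a::comm_ring_1) set" where
  "free_on B = {c. Poly_Mapping.keys c \<subseteq> B}"

text \<open>
  \<open>\<cdots> \<rightarrow> F\<^sub>2 \<rightarrow> F\<^sub>1 \<rightarrow> F\<^sub>0 \<rightarrow> R/I \<rightarrow> 0\<close> is exact, where \<open>F\<^sub>i = free_on (B i)\<close>, all differentials are
  restrictions of \<open>d\<close>, and the augmentation sends \<open>c\<close> to the residue class of \<open>\<epsilon> c\<close>.
\<close>

definition free_resolution ::
  "(nat \<Rightarrow> 'b set) \<Rightarrow> (('b \<Rightarrow>\<^sub>0 'a) \<Rightarrow> ('b \<Rightarrow>\<^sub>0 'a)) \<Rightarrow> (('b \<Rightarrow>\<^sub>0 'a) \<Rightarrow> 'a) \<Rightarrow> 'a::comm_ring_1 set \<Rightarrow> bool"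
where
  "free_resolution B d \<epsilon> I \<longleftrightarrow>
     module_hom scal scal d \<and> module_hom scal (*) \<epsilon> \<and>
     (\<forall>i. d ` free_on (B (Suc i)) \<subseteq> free_on (B i)) \<and>
     (\<forall>q. \<exists>c\<in>free_on (B 0). q - \<epsilon> c \<in> I) \<and>
     d ` free_on (B 1) = {c \<in> free_on (B 0). \<epsilon> c \<in> I} \<and>
     (\<forall>i. d ` free_on (B (Suc (Suc i))) = {c \<in> free_on (B (Suc i)). d c = 0})"

text \<open>Minimality: every differential maps into the graded maximal ideal times its target.\<close>

definition minimal_free_resolution ::
  "(nat \<Rightarrow> 'b set) \<Rightarrow> (('b \<Rightarrow>\<^sub>0 ('v, 'k) mpoly) \<Rightarrow> ('b \<Rightarrow>\<^sub>0 ('v, 'k) mpoly)) \<Rightarrow>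
   (('b \<Rightarrow>\<^sub>0 ('v, 'k) mpoly) \<Rightarrow> ('v, 'k) mpoly) \<Rightarrow> ('v, 'k::field) mpoly set \<Rightarrow> bool"
where
  "minimal_free_resolution B d \<epsilon> I \<longleftrightarrow>
     free_resolution B d \<epsilon> I \<and>
     (\<forall>i. \<forall>c\<in>free_on (B (Suc i)). \<forall>b. Poly_Mapping.lookup (d c) b \<in> ideal_gen (range Var))"


section \<open>Taylor resolution and Scarf ideals\<close>

text \<open>
  The list \<open>ms\<close> enumerates the minimal generators and fixes the signs. The basis element \<open>e\<^sub>\<sigma>\<close>
  is \<open>Poly_Mapping.single \<sigma> 1\<close>; positions are counted from \<open>0\<close>, and the subtraction is that of
  exponent vectors.
\<close>

definition taylor_boundary ::
  "'v::finite monom list \<Rightarrow> 'v monom set \<Rightarrow> ('v monom set \<Rightarrow>\<^sub>0 ('v, 'k::field) mpoly)" where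
  "taylor_boundary ms \<sigma> =
     (let l = filter (\<lambda>m. m \<in> \<sigma>) ms in
      \<Sum>j<length l. Poly_Mapping.single (\<sigma> - {l ! j})
        ((-1) ^ j * mono_poly (mlcm \<sigma> - mlcm (\<sigma> - {l ! j}))))"

definition taylor_diff ::
  "'v::finite monom list \<Rightarrow>
   ('v monom set \<Rightarrow>\<^sub>0 ('v, 'k::field) mpoly) \<Rightarrow> ('v monom set \<Rightarrow>\<^sub>0 ('v, 'k) mpoly)" where
  "taylor_diff ms c = (\<Sum>\<sigma>\<in>Poly_Mapping.keys c. scal (Poly_Mapping.lookup c \<sigma>) (taylor_boundary ms \<sigma>))"

definition scarf_complex :: "('v::finite, 'k::field) mpoly set \<Rightarrow> 'v monom set set" where
  "scarf_complex I =
     {\<sigma>. \<sigma> \<subseteq> mingens I \<and> (\<forall>\<tau>. \<tau> \<subseteq> mingens I \<and> \<tau> \<noteq> \<sigma> \<longrightarrow> mlcm \<sigma> \<noteq> mlcm \<tau>)}"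

text \<open>
  Reordering the minimal generators only changes the basis elements \<open>e\<^sub>\<sigma>\<close> by signs, so it is
  immaterial which ordering is used. The augmentation sends \<open>e\<^sub>\<emptyset>\<close> to \<open>1\<close>.
\<close>

definition scarf_ideal :: "('v::finite, 'k::field) mpoly set \<Rightarrow> bool" where
  "scarf_ideal I \<longleftrightarrow>
     (\<exists>ms. distinct ms \<and> set ms = mingens I \<and>
        minimal_free_resolution (\<lambda>i. {\<sigma> \<in> scarf_complex I. card \<sigma> = i})
          (taylor_diff ms) (\<lambda>c. Poly_Mapping.lookup c {}) I)"


section \<open>Basic facts\<close>

lemma lookup_mlcm: "Poly_Mapping.lookup (mlcm \<sigma>) v = Max (insert 0 ((\<lambda>t. Poly_Mapping.lookup t v) ` \<sigma>))"
  by (simp add: mlcm_def)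

lemma module_mult: "module ((*) :: 'a::comm_ring_1 \<Rightarrow> 'a \<Rightarrow> 'a)"
  by unfold_locales (simp_all add: algebra_simps)

lemma lookup_scal [simp]: "Poly_Mapping.lookup (scal p c) b = p * Poly_Mapping.lookup c b"
  by (simp add: scal_def Poly_Mapping.map.rep_eq when_def)

lemma module_scal: "module (scal :: 'a::comm_ring_1 \<Rightarrow> ('b \<Rightarrow>\<^sub>0 'a) \<Rightarrow> _)"
  by unfold_locales (auto intro!: poly_mapping_eqI simp: lookup_add algebra_simps)

lemma module_hom_lookup: "module_hom scal (*) (\<lambda>c. Poly_Mapping.lookup c b)"
  unfolding module_hom_def module_hom_axioms_def
  by (simp add: module_mult module_scal lookup_add)

lemma module_hom_taylor_diff: "module_hom scal scal (taylor_diff ms)"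
proof -
  interpret S: module "scal :: _ \<Rightarrow> ('a monom set \<Rightarrow>\<^sub>0 ('a, 'b) mpoly) \<Rightarrow> _"
    by (rule module_scal)
  have superset: "taylor_diff ms c = (\<Sum>\<sigma>\<in>A. scal (Poly_Mapping.lookup c \<sigma>) (taylor_boundary ms \<sigma>))"
    if "finite A" "Poly_Mapping.keys c \<subseteq> A" for A and c :: "'a monom set \<Rightarrow>\<^sub>0 ('a, 'b) mpoly"
    unfolding taylor_diff_def
    by (rule sum.mono_neutral_left) (use that in \<open>auto simp: in_keys_iff\<close>)
  have "taylor_diff ms (b + c) = taylor_diff ms b + taylor_diff ms c"
    for b c :: "'a monom set \<Rightarrow>\<^sub>0 ('a, 'b) mpoly"
    using superset[of "Poly_Mapping.keys b \<union> Poly_Mapping.keys c" b] superset[of "Poly_Mapping.keys b \<union> Poly_Mapping.keys c" c]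
      superset[of "Poly_Mapping.keys b \<union> Poly_Mapping.keys c" "b + c"] Poly_Mapping.keys_add[of b c]
    by (simp add: lookup_add S.scale_left_distrib sum.distrib)
  moreover have "taylor_diff ms (scal p c) = scal p (taylor_diff ms c)"
    for p and c :: "'a monom set \<Rightarrow>\<^sub>0 ('a, 'b) mpoly"
  proof -
    have "Poly_Mapping.keys (scal p c) \<subseteq> Poly_Mapping.keys c"
      by (auto simp: in_keys_iff)
    then show ?thesis
      using superset[of "Poly_Mapping.keys c" "scal p c"] superset[of "Poly_Mapping.keys c" c]
      by (simp add: S.scale_sum_right)
  qed
  ultimately show ?thesis
    by (simp add: module_hom_def module_hom_axioms_def module_scal)
qed

lemma ideal_gen_mono_dvd:
  fixes A :: "'v monom set"
  assumes "(p :: ('v, 'k::field) mpoly) \<in> ideal_gen (mono_poly ` A)" and "t \<in> Poly_Mapping.keys p"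
  shows "\<exists>s\<in>A. mdvd s t"
proof -
  interpret M: module "(*) :: ('v, 'k) mpoly \<Rightarrow> _" by (rule module_mult)
  have "\<forall>t\<in>Poly_Mapping.keys p. \<exists>s\<in>A. mdvd s t"
    using assms(1) unfolding ideal_gen_def
  proof (induction p rule: M.span_induct_alt)
    case base
    then show ?case by simp
  next
    case (step q x y)
    then obtain s where s: "s \<in> A" "x = mono_poly s" by auto
    have "mdvd s u" if u: "u \<in> Poly_Mapping.keys (q * x)" for u
      using subsetD[OF Poly_Mapping.keys_mult u]
      by (auto simp: s mono_poly_def mdvd_def lookup_add)
    then show ?case
      using s(1) step.IH Poly_Mapping.keys_add[of "q * x" y] by blast
  qed
  then show ?thesis using assms(2) by blast
qed

lemma mono_poly_in_ideal_gen_iff: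
  "(mono_poly t :: ('v, 'k::field) mpoly) \<in> ideal_gen (mono_poly ` A) \<longleftrightarrow> (\<exists>s\<in>A. mdvd s t)"
proof
  assume "(mono_poly t :: ('v, 'k) mpoly) \<in> ideal_gen (mono_poly ` A)"
  then show "\<exists>s\<in>A. mdvd s t"
    by (rule ideal_gen_mono_dvd) (simp add: mono_poly_def)
next
  interpret M: module "(*) :: ('v, 'k) mpoly \<Rightarrow> _" by (rule module_mult)
  assume "\<exists>s\<in>A. mdvd s t"
  then obtain s where s: "s \<in> A" "mdvd s t" by blast
  have "(t - s) + s = t"
    using s(2) by (intro poly_mapping_eqI) (simp add: lookup_add lookup_minus mdvd_def)
  then have "mono_poly t = mono_poly (t - s) * (mono_poly s :: ('v, 'k) mpoly)"
    by (simp add: mono_poly_def mult_single)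
  then show "(mono_poly t :: ('v, 'k) mpoly) \<in> ideal_gen (mono_poly ` A)"
    using s(1) by (simp add: ideal_gen_def M.span_base M.span_scale)
qed

lemma mdvd_minimal:
  assumes "P t"
  shows "\<exists>s. P s \<and> mdvd s t \<and> (\<forall>u. P u \<and> mdvd u s \<longrightarrow> u = (s :: 'v::finite monom))"
  using assms
proof (induction "\<Sum>v\<in>UNIV. Poly_Mapping.lookup t v" arbitrary: t rule: less_induct)
  case less
  show ?case
  proof (cases "\<forall>u. P u \<and> mdvd u t \<longrightarrow> u = t")
    case True
    then show ?thesis using less.prems by (auto simp: mdvd_def)
  next
    case False
    then obtain u where u: "P u" "mdvd u t" "u \<noteq> t" by blast
    then obtain v where "Poly_Mapping.lookup u v \<noteq> Poly_Mapping.lookup t v" by (meson poly_mapping_eqI)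
    with u(2) have "Poly_Mapping.lookup u v < Poly_Mapping.lookup t v" by (simp add: mdvd_def le_neq_implies_less)
    then have "(\<Sum>v\<in>UNIV. Poly_Mapping.lookup u v) < (\<Sum>v\<in>UNIV. Poly_Mapping.lookup t v)"
      using u(2) by (intro sum_strict_mono_ex1) (auto simp: mdvd_def)
    from less.hyps[OF this u(1)] u(2) show ?thesis
      by (meson mdvd_def order_trans)
  qed
qed

lemma mingens_generate:
  fixes A :: "'v::finite monom set"
  assumes "I = ideal_gen (mono_poly ` A)"
  shows "ideal_gen (mono_poly ` mingens I) = (I :: ('v, 'k::field) mpoly set)"
proof -
  interpret M: module "(*) :: ('v, 'k) mpoly \<Rightarrow> _" by (rule module_mult)
  have "mono_poly ` mingens I \<subseteq> I" by (auto simp: mingens_def)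
  then have "ideal_gen (mono_poly ` mingens I) \<subseteq> I"
    using assms by (metis M.span_minimal M.subspace_span ideal_gen_def)
  moreover have "mono_poly t \<in> ideal_gen (mono_poly ` mingens I)" if "t \<in> A" for t
  proof -
    have "mono_poly t \<in> I" using that assms by (simp add: ideal_gen_def M.span_base)
    from mdvd_minimal[where P = "\<lambda>s. mono_poly s \<in> I", OF this]
    show ?thesis by (auto simp: mono_poly_in_ideal_gen_iff mingens_def)
  qed
  then have "I \<subseteq> ideal_gen (mono_poly ` mingens I)"
    unfolding assms ideal_gen_def by (intro M.span_minimal M.subspace_span) auto
  ultimately show ?thesis by blast
qed

lemma mingens_least:
  assumes "I = ideal_gen (mono_poly ` A)"
  shows "mingens (I :: ('v, 'k::field) mpoly set) \<subseteq> A"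
proof
  fix t assume t: "t \<in> mingens I"
  then obtain s where s: "s \<in> A" "mdvd s t"
    using assms by (auto simp: mingens_def mono_poly_in_ideal_gen_iff)
  then have "(mono_poly s :: ('v, 'k) mpoly) \<in> I"
    using assms by (auto simp: mono_poly_in_ideal_gen_iff mdvd_def)
  with t s show "t \<in> A" by (auto simp: mingens_def)
qed

end

theory Submission
  imports Defs
begin

text \<open>
  Complements of minimal vertex covers of \<open>G\<close> are the maximal cliques of the complement \<open>H\<close>, and \<open>H\<close> is
  chordal iff these cliques can be enumerated so that each new clique \<open>K\<close> has an earlier clique
  (its parent) containing the intersection of \<open>K\<close> with every earlier clique. In terms of the minimal
  generators of \<open>J(G)\<close> this says that the parent of \<open>m\<close> divides \<open>lcm(m, q)\<close> for all earlier \<open>q\<close>.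
  Such a join tree with \<open>n - 1\<close> edges contains every edge of the Scarf complex, and it supports a
  resolution: cycles are reduced to \<open>0\<close> from the last generator on. So if the Scarf complex has
  \<open>n - 1\<close> edges, it is this tree.

  Conversely, the Scarf complex of a cover ideal has dimension at most one. If it supports a
  resolution, exactness in degree \<open>lcm(x, y)\<close> provides, for every cut separating \<open>x\<close> from \<open>y\<close>, a
  crossing edge whose ends divide \<open>lcm(x, y)\<close>, and injectivity of the last differential excludes
  cycles; so the graph is a tree, and removing leaves one by one shows that it is a join tree.
\<close>

section \<open>Join trees\<close>

text \<open>Read \<open>R p m q\<close> as: \<open>p\<close> lies between \<open>m\<close> and
  \<open>q\<close>. Trees grow by leaves, so later inductions peel off the leaf inserted last. Three
  relations occur: the trivial one (plain spanning trees), containment of an intersection of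
  cliques, and divisibility into an lcm.\<close>

inductive join_tree :: "('a \<Rightarrow> 'a \<Rightarrow> 'a \<Rightarrow> bool) \<Rightarrow> 'a set \<Rightarrow> 'a set set \<Rightarrow> bool" for R where
  single: "join_tree R {m} {}"
| leaf: "join_tree R F T \<Longrightarrow> m \<notin> F \<Longrightarrow> p \<in> F \<Longrightarrow> (\<And>q. q \<in> F \<Longrightarrow> R p m q) \<Longrightarrow>
    join_tree R (insert m F) (insert {m, p} T)"

lemma join_tree_edgeE:
  "join_tree R F T \<Longrightarrow> e \<in> T \<Longrightarrow> \<exists>x\<in>F. \<exists>y\<in>F. x \<noteq> y \<and> e = {x, y}"
proof (induction rule: join_tree.induct)
  case (leaf F T m p)
  then have "m \<noteq> p" by blast
  then show ?case using leaf.IH leaf.hyps(3) leaf.prems by blast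
qed simp

lemma join_tree_edge_subset: "join_tree R F T \<Longrightarrow> e \<in> T \<Longrightarrow> e \<subseteq> F"
  using join_tree_edgeE by fastforce

lemma join_tree_finite: "join_tree R F T \<Longrightarrow> finite F \<and> finite T"
  by (induction rule: join_tree.induct) auto

lemma join_tree_card: "join_tree R F T \<Longrightarrow> card F = Suc (card T)"
proof (induction rule: join_tree.induct)
  case (leaf F T m p)
  have "{m, p} \<notin> T"
    using join_tree_edge_subset[OF leaf.hyps(1)] leaf.hyps(2) by blast
  then show ?case
    using leaf join_tree_finite[OF leaf.hyps(1)] by simp
qed simp

text \<open>A leaf is never compared with itself, so compatibility of \<open>g\<close> is asked only
  for \<open>m \<noteq> q\<close>. This matters when \<open>g\<close> adds a vertex to just one
  clique of a clique tree.\<close>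

lemma join_tree_image:
  assumes "join_tree R F T" and "inj_on g F"
    and "\<And>p m q. p \<in> F \<Longrightarrow> m \<in> F \<Longrightarrow> q \<in> F \<Longrightarrow> m \<noteq> q \<Longrightarrow> R p m q \<Longrightarrow> R' (g p) (g m) (g q)"
  shows "join_tree R' (g ` F) ((`) g ` T)"
  using assms
proof (induction rule: join_tree.induct)
  case (single m)
  show ?case using join_tree.single[of R' "g m"] by simp
next
  case (leaf F T m p)
  have "join_tree R' (g ` F) ((`) g ` T)"
    using leaf.prems by (intro leaf.IH) (auto simp: inj_on_def)
  moreover have "g m \<notin> g ` F"
    using leaf.hyps(2) leaf.prems(1) by auto
  moreover have "R' (g p) (g m) x" if x: "x \<in> g ` F" for x
  proof -
    from x obtain q where q: "q \<in> F" "x = g q" by auto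
    then show ?thesis
      using leaf.prems(2)[of p m q] leaf.hyps by auto
  qed
  ultimately show ?case
    using join_tree.leaf[of R' "g ` F" "(`) g ` T" "g m" "g p"] leaf.hyps(3) by simp
qed

text \<open>Of \<open>x\<close> and \<open>y\<close>, consider the one inserted later: its parent
  lies between the two and hence is the other one.\<close>

lemma join_tree_edgeI:
  assumes "join_tree R F T" and "x \<in> F" "y \<in> F" "x \<noteq> y"
    and "\<And>z. z \<in> F \<Longrightarrow> R z x y \<Longrightarrow> z \<in> {x, y}" and "\<And>p m q. R p m q \<Longrightarrow> R p q m"
  shows "{x, y} \<in> T"
  using assms
proof (induction rule: join_tree.induct)
  case (leaf F T m p)
  consider "x = m" "y \<in> F" | "y = m" "x \<in> F" | "x \<in> F" "y \<in> F"
    using leaf.prems by blast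
  then show ?case
  proof cases
    case 1
    then have "p = y" using leaf.prems(4)[of p] leaf.hyps by auto
    then show ?thesis using 1 by simp
  next
    case 2
    then have "p = x" using leaf.prems(4)[of p] leaf.prems(5) leaf.hyps by blast
    then show ?thesis using 2 by (simp add: insert_commute)
  next
    case 3
    then show ?thesis using leaf.IH leaf.prems by blast
  qed
qed auto

text \<open>Peel off the leaf \<open>m\<close>. Only \<open>{m, p}\<close> crosses the cut
  \<open>{m}\<close>, so the cut condition there yields \<open>R p m q\<close>. The condition is
  inherited by the smaller tree because each cut can be adjusted at \<open>m\<close> so that
  \<open>{m, p}\<close> does not cross it.\<close>

lemma join_tree_of_cuts:
  assumes "join_tree (\<lambda>_ _ _. True) F T"
    and "\<And>C x y. x \<in> C \<Longrightarrow> x \<in> F \<Longrightarrow> y \<in> F \<Longrightarrow> y \<notin> C \<Longrightarrow>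
      \<exists>a b. {a, b} \<in> T \<and> a \<in> C \<and> b \<notin> C \<and> R a x y \<and> R b x y"
  shows "join_tree R F T"
  using assms
proof (induction rule: join_tree.induct)
  case (single m)
  show ?case by (rule join_tree.single)
next
  case (leaf F T m p)
  have no_m: "m \<notin> e" if "e \<in> T" for e
    using join_tree_edge_subset[OF leaf.hyps(1) that] leaf.hyps(2) by blast
  have "join_tree R F T"
  proof (rule leaf.IH)
    fix C x y assume xy: "x \<in> C" "x \<in> F" "y \<in> F" "y \<notin> C"
    \<comment> \<open>Puts \<open>m\<close> on the side of its parent \<open>p\<close> and changes
      nothing else.\<close>
    define C' where "C' = (if p \<in> C then insert m C else C - {m})"
    have "x \<in> C'" "y \<notin> C'" and C': "p \<in> C' \<longleftrightarrow> m \<in> C'" "\<And>z. z \<noteq> m \<Longrightarrow> z \<in> C' \<longleftrightarrow> z \<in> C"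
      using xy leaf.hyps(2,3) by (auto simp: C'_def)
    then obtain a b where ab: "{a, b} \<in> insert {m, p} T" "a \<in> C'" "b \<notin> C'" "R a x y" "R b x y"
      using leaf.prems[of x C' y] xy by blast
    then have "{a, b} \<in> T" using C'(1) by (auto simp: doubleton_eq_iff)
    moreover from no_m[OF this] have "a \<in> C" "b \<notin> C" using C'(2) ab by auto
    ultimately show "\<exists>a b. {a, b} \<in> T \<and> a \<in> C \<and> b \<notin> C \<and> R a x y \<and> R b x y"
      using ab by blast
  qed
  moreover have "R p m q" if q: "q \<in> F" for q
  proof -
    obtain b where "{m, b} \<in> insert {m, p} T" "b \<noteq> m" "R b m q"
      using leaf.prems[of m "{m}" q] q leaf.hyps(2) by auto
    then show ?thesis using no_m[of "{m, b}"] by (auto simp: doubleton_eq_iff)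
  qed
  ultimately show ?case
    using leaf.hyps by (intro join_tree.leaf)
qed

text \<open>Greedy growth: the vertex set \<open>F\<close> of a partial tree is itself a cut, and an
  edge crossing it attaches the next leaf.\<close>

lemma spanning_tree_of_cuts:
  assumes "finite M" "M \<noteq> {}" and "\<And>e. e \<in> T \<Longrightarrow> e \<subseteq> M"
    and cuts: "\<And>C x y. x \<in> C \<Longrightarrow> x \<in> M \<Longrightarrow> y \<in> M \<Longrightarrow> y \<notin> C \<Longrightarrow>
      \<exists>a b. {a, b} \<in> T \<and> a \<in> C \<and> b \<notin> C"
  shows "\<exists>T0 \<subseteq> T. join_tree (\<lambda>_ _ _. True) M T0"
proof -
  have "\<exists>F T0. F \<subseteq> M \<and> T0 \<subseteq> T \<and> card F = Suc k \<and> join_tree (\<lambda>_ _ _. True) F T0"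
    if "k < card M" for k
    using that
  proof (induction k)
    case 0
    from \<open>M \<noteq> {}\<close> obtain m where "m \<in> M" by blast
    then show ?case
      by (intro exI[of _ "{m}"] exI[of _ "{}"]) (auto intro: join_tree.single)
  next
    case (Suc k)
    then obtain F T0 where F: "F \<subseteq> M" "T0 \<subseteq> T" "card F = Suc k" "join_tree (\<lambda>_ _ _. True) F T0"
      by auto
    then have "F \<noteq> M" "F \<noteq> {}" using Suc.prems by auto
    then obtain x y where xy: "x \<in> F" "y \<in> M" "y \<notin> F" using F(1) by blast
    then obtain a b where ab: "{a, b} \<in> T" "a \<in> F" "b \<notin> F"
      using cuts[of x F y] F(1) by blast
    have "join_tree (\<lambda>_ _ _. True) (insert b F) (insert {b, a} T0)"
      using F(4) ab by (intro join_tree.leaf) auto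
    moreover have "insert b F \<subseteq> M" "insert {b, a} T0 \<subseteq> T"
      using F ab assms(3)[OF ab(1)] by (auto simp: insert_commute)
    moreover have "card (insert b F) = Suc (Suc k)"
      using F(3) ab(3) finite_subset[OF F(1) assms(1)] by simp
    ultimately show ?case by blast
  qed
  from this[of "card M - 1"] obtain F T0
    where F: "F \<subseteq> M" "T0 \<subseteq> T" "card F = card M" "join_tree (\<lambda>_ _ _. True) F T0"
    using assms(1,2) by (auto simp: card_gt_0_iff)
  then have "F = M" using assms(1) card_subset_eq by blast
  then show ?thesis using F by blast
qed


section \<open>Chordal graphs and maximal cliques\<close>

definition clique :: "'v set set \<Rightarrow> 'v set \<Rightarrow> bool" where
  "clique H K \<longleftrightarrow> (\<forall>u\<in>K. \<forall>v\<in>K. u \<noteq> v \<longrightarrow> {u, v} \<in> H)"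

text \<open>Relative to \<open>A\<close>, so that vertices can be deleted one by one. Testing
  maximality against a single extra vertex suffices because subsets of cliques are cliques.\<close>

definition max_cliques :: "'v set set \<Rightarrow> 'v set \<Rightarrow> 'v set set" where
  "max_cliques H A = {K. K \<subseteq> A \<and> clique H K \<and> (\<forall>v\<in>A - K. \<not> clique H (insert v K))}"

text \<open>This is the running intersection property of junction trees.\<close>

abbreviation clique_tree :: "'v set set \<Rightarrow> 'v set set set \<Rightarrow> bool" where
  "clique_tree \<equiv> join_tree (\<lambda>P K L. K \<inter> L \<subseteq> P)"

lemma clique_subset: "clique H K \<Longrightarrow> L \<subseteq> K \<Longrightarrow> clique H L"
  by (auto simp: clique_def)

lemma cliqueD: "clique H K \<Longrightarrow> u \<in> K \<Longrightarrow> v \<in> K \<Longrightarrow> u \<noteq> v \<Longrightarrow> {u, v} \<in> H"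
  by (simp add: clique_def)

lemma clique_extend:
  assumes "finite A" "K \<subseteq> A" "clique H K"
  shows "\<exists>P\<in>max_cliques H A. K \<subseteq> P"
proof -
  obtain P where P: "K \<subseteq> P" "P \<in> {L. L \<subseteq> A \<and> clique H L}"
    and max: "\<forall>L\<in>{L. L \<subseteq> A \<and> clique H L}. P \<subseteq> L \<longrightarrow> P = L"
    using finite_has_maximal2[of "{L. L \<subseteq> A \<and> clique H L}" K] assms by auto
  have "\<not> clique H (insert v P)" if "v \<in> A - P" for v
    using max P(2) that by blast
  then show ?thesis using P by (auto simp: max_cliques_def)
qed

lemma clique_tree_no_cycle:
  assumes "clique_tree F T" and "\<And>K. K \<in> F \<Longrightarrow> clique H K"
    and "X \<noteq> {}"
    and "\<And>x. x \<in> X \<Longrightarrow> \<exists>y\<in>X. \<exists>z\<in>X. {x, y} \<in> H \<and> {x, z} \<in> H \<and> y \<noteq> z \<and> {y, z} \<notin> H"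
    and "\<And>x y. x \<in> X \<Longrightarrow> y \<in> X \<Longrightarrow> {x, y} \<in> H \<Longrightarrow> \<exists>K\<in>F. x \<in> K \<and> y \<in> K"
  shows False
  using assms
proof (induction rule: join_tree.induct)
  case (single K)
  from single.prems(2) obtain x where x: "x \<in> X" by blast
  then obtain y z where yz: "y \<in> X" "z \<in> X" "{x, y} \<in> H" "{x, z} \<in> H" "y \<noteq> z" "{y, z} \<notin> H"
    using single.prems(3) by blast
  then have "y \<in> K" "z \<in> K"
    using single.prems(4)[of x y] single.prems(4)[of x z] x by auto
  then show False using single.prems(1)[of K] yz cliqueD[of H K y z] by simp
next
  case (leaf F T K P)
  show False
  proof (cases "\<forall>x\<in>X. \<forall>y\<in>X. {x, y} \<in> H \<longrightarrow> (\<exists>K\<in>F. x \<in> K \<and> y \<in> K)")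
    case True
    show False
      using True by (intro leaf.IH leaf.prems) auto
  next
    case False
    then obtain x' y' where xy': "x' \<in> X" "y' \<in> X" "{x', y'} \<in> H" "\<not> (\<exists>K\<in>F. x' \<in> K \<and> y' \<in> K)"
      by blast
    then have "x' \<in> K" "y' \<in> K" using leaf.prems(4)[of x' y'] by auto
    \<comment> \<open>If both ends lay in earlier cliques, running intersection would put both into
      the parent \<open>P\<close>, which is an earlier clique.\<close>
    then have "x' \<notin> \<Union>F \<or> y' \<notin> \<Union>F" using leaf.hyps xy'(4) by blast
    then obtain x where x: "x \<in> X" "x \<notin> \<Union>F" using xy' by blast
    then obtain y z where yz: "y \<in> X" "z \<in> X" "{x, y} \<in> H" "{x, z} \<in> H" "y \<noteq> z" "{y, z} \<notin> H"
      using leaf.prems(3) by blast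
    then have "y \<in> K" "z \<in> K"
      using leaf.prems(4)[of x y] leaf.prems(4)[of x z] x by auto
    then show False using leaf.prems(1)[of K] yz cliqueD[of H K y z] by simp
  qed
qed

lemma chordal_of_clique_tree:
  fixes H :: "'v::finite set set"
  assumes loopless: "\<And>v. {v} \<notin> H" and tree: "clique_tree (max_cliques H UNIV) T"
  shows "chordal H"
  unfolding chordal_def
proof
  assume "\<exists>xs. induced_cycle H xs \<and> 4 \<le> length xs"
  then obtain xs where dist: "distinct xs" and len: "4 \<le> length xs"
    and adj: "\<And>i j. i < length xs \<Longrightarrow> j < length xs \<Longrightarrow>
      {xs ! i, xs ! j} \<in> H \<longleftrightarrow> j = Suc i mod length xs \<or> i = Suc j mod length xs"
    by (auto simp: induced_cycle_def)
  show False
  proof (rule clique_tree_no_cycle[OF tree, of H "set xs"])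
    show "clique H K" if "K \<in> max_cliques H UNIV" for K
      using that by (simp add: max_cliques_def)
    show "set xs \<noteq> {}" using len by auto
    show "\<exists>K\<in>max_cliques H UNIV. x \<in> K \<and> y \<in> K" if "{x, y} \<in> H" for x y
      using clique_extend[of UNIV "{x, y}" H] that by (auto simp: clique_def insert_commute)
    show "\<exists>y\<in>set xs. \<exists>z\<in>set xs. {x, y} \<in> H \<and> {x, z} \<in> H \<and> y \<noteq> z \<and> {y, z} \<notin> H"
      if x: "x \<in> set xs" for x
    proof -
      let ?n = "length xs"
      obtain i where i: "i < ?n" "x = xs ! i" using x by (auto simp: in_set_conv_nth)
      \<comment> \<open>\<open>j\<close> and \<open>k\<close> are the two neighbours of
        \<open>i\<close> on the cycle. Length at least 4 keeps them distinct and
        nonadjacent.\<close>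
      define j where "j = (if Suc i = ?n then 0 else Suc i)"
      define k where "k = (if i = 0 then ?n - 1 else i - 1)"
      have jk: "j < ?n" "k < ?n" using i len by (auto simp: j_def k_def)
      have "j = Suc i mod ?n" "i = Suc k mod ?n" using i len by (auto simp: j_def k_def)
      moreover have "j \<noteq> k" using i len by (auto simp: j_def k_def)
      moreover have "Suc j mod ?n \<noteq> k" "Suc k mod ?n \<noteq> j"
        using i len by (auto simp: j_def k_def mod_Suc split: if_splits)
      ultimately show ?thesis
        using adj[of i j] adj[of i k] adj[of j k] i jk nth_eq_iff_index_eq[OF dist, of j k]
        by (metis nth_mem)
    qed
  qed
qed

section \<open>Connected sets, simplicial vertices and elimination in chordal graphs\<close>

definition connected_in :: "'v set set \<Rightarrow> 'v set \<Rightarrow> bool" where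
  "connected_in H C \<longleftrightarrow> (\<forall>u\<in>C. \<forall>v\<in>C. (u, v) \<in> {(a, b). a \<in> C \<and> b \<in> C \<and> {a, b} \<in> H}\<^sup>*)"

lemma connected_in_insert:
  assumes "connected_in H C" "c \<in> C" "{c, x} \<in> H"
  shows "connected_in H (insert x C)"
proof -
  let ?R = "\<lambda>C. {(a, b). a \<in> C \<and> b \<in> C \<and> {a, b} \<in> H}"
  have mono: "(?R C)\<^sup>* \<subseteq> (?R (insert x C))\<^sup>*" by (intro rtrancl_mono) auto
  have "(c, x) \<in> (?R (insert x C))\<^sup>*" "(x, c) \<in> (?R (insert x C))\<^sup>*"
    using assms by (auto simp: insert_commute intro!: r_into_rtrancl)
  moreover have "(u, v) \<in> (?R (insert x C))\<^sup>*" if "u \<in> C" "v \<in> C" for u v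
    using assms(1) that mono unfolding connected_in_def by blast
  ultimately show ?thesis
    using assms(2) unfolding connected_in_def by (metis (no_types, lifting) insert_iff rtrancl.rtrancl_refl rtrancl_trans)
qed

text \<open>A shortest path from \<open>x\<close> to \<open>y\<close> through \<open>C\<close>, closed up by \<open>d\<close>, is an induced cycle.\<close>

lemma chordal_separator_adjacent:
  fixes H :: "'v set set"
  assumes loopless: "\<And>v. {v} \<notin> H" and "chordal H" and conn: "connected_in H C"
    and x: "x \<notin> C" "a \<in> C" "{x, a} \<in> H" and y: "y \<notin> C" "b \<in> C" "{y, b} \<in> H"
    and d: "d \<notin> C" "{d, x} \<in> H" "{d, y} \<in> H" "\<And>c. c \<in> C \<Longrightarrow> {d, c} \<notin> H"
    and "x \<noteq> y"
  shows "{x, y} \<in> H"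
proof (rule ccontr)
  assume nadj: "{x, y} \<notin> H"
  define R where "R = {(u, v). u \<in> C \<union> {x, y} \<and> v \<in> C \<union> {x, y} \<and> {u, v} \<in> H}"
  have "(a, b) \<in> {(a, b). a \<in> C \<and> b \<in> C \<and> {a, b} \<in> H}\<^sup>*"
    using conn x y by (auto simp: connected_in_def)
  then have "(a, b) \<in> R\<^sup>*"
    by (rule rtrancl_mono[THEN subsetD, rotated]) (auto simp: R_def)
  moreover have "(x, a) \<in> R" "(b, y) \<in> R" using x y by (auto simp: R_def insert_commute)
  ultimately have "(x, y) \<in> R\<^sup>*" by (meson rtrancl.rtrancl_into_rtrancl converse_rtrancl_into_rtrancl)
  then obtain l0 where "(x, y) \<in> R ^^ l0" using rtrancl_imp_relpow by blast
  define l where "l = (LEAST l. (x, y) \<in> R ^^ l)"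
  have l: "(x, y) \<in> R ^^ l" and least: "\<And>k. (x, y) \<in> R ^^ k \<Longrightarrow> l \<le> k"
    unfolding l_def using \<open>(x, y) \<in> R ^^ l0\<close> by (auto intro: LeastI Least_le)
  from l obtain w where w: "w 0 = x" "w l = y" "\<And>i. i < l \<Longrightarrow> (w i, w (Suc i)) \<in> R"
    by (auto simp: relpow_fun_conv)
  have pre: "(x, w i) \<in> R ^^ i" if "i \<le> l" for i
    unfolding relpow_fun_conv using that w by (intro exI[of _ w]) auto
  have suf: "(w i, y) \<in> R ^^ (l - i)" if "i \<le> l" for i
    unfolding relpow_fun_conv using that w by (intro exI[of _ "\<lambda>k. w (i + k)"]) auto
  \<comment> \<open>Together with \<open>d\<close> the closed path has \<open>l + 2\<close>
    vertices, so this makes it long enough to contradict chordality.\<close>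
  have l2: "2 \<le> l"
  proof (rule ccontr)
    assume "\<not> 2 \<le> l"
    then consider "l = 0" | "l = 1" by linarith
    then show False using l nadj \<open>x \<noteq> y\<close> by cases (auto simp: R_def)
  qed
  have distinct: "w i \<noteq> w j" if "i < j" "j \<le> l" for i j
  proof
    assume "w i = w j"
    then have "(x, y) \<in> R ^^ (i + (l - j))"
      using pre[of i] suf[of j] that by (subst relpow_add) auto
    then show False using least that by fastforce
  qed
  have mem: "w i \<in> C \<union> {x, y}" if "i \<le> l" for i
  proof (cases "i = l")
    case False
    then show ?thesis using w(3)[of i] that by (auto simp: R_def)
  qed (simp add: w)
  have interior: "w i \<in> C" if "0 < i" "i < l" for i
    using mem[of i] that distinct[of 0 i] distinct[of i l] w by auto
  \<comment> \<open>A chord would be a shortcut, contradicting the minimality of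
    \<open>l\<close>.\<close>
  have chordless: "{w i, w j} \<in> H \<longleftrightarrow> j = Suc i" if "i < j" "j \<le> l" for i j
  proof
    assume "{w i, w j} \<in> H"
    then have "(w i, w j) \<in> R" using mem that by (auto simp: R_def)
    then have "(x, w j) \<in> R ^^ Suc i" using pre[of i] that by auto
    then have "(x, y) \<in> R ^^ (Suc i + (l - j))"
      using suf[of j] that by (subst relpow_add) auto
    then show "j = Suc i" using least[of "Suc i + (l - j)"] that by simp
  qed (use w(3)[of i] that in \<open>auto simp: R_def\<close>)
  have adj_w: "{w i, w j} \<in> H \<longleftrightarrow> j = Suc i \<or> i = Suc j" if "i \<le> l" "j \<le> l" for i j
    using chordless[of i j] chordless[of j i] that loopless[of "w i"]
    by (cases i j rule: linorder_cases) (auto simp: insert_commute)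
  have adj_d: "{d, w i} \<in> H \<longleftrightarrow> i = 0 \<or> i = l" if "i \<le> l" for i
    using that interior[of i] d w by (cases "i = 0 \<or> i = l") auto
  have d_neq: "w i \<noteq> d" if "i \<le> l" for i
    using mem[OF that] d loopless[of d] by auto
  \<comment> \<open>The indices \<open>0\<close> to \<open>l\<close> run along the path and
    \<open>Suc l\<close> is \<open>d\<close>, so the successor modulo \<open>l + 2\<close> closes
    the cycle.\<close>
  define xs where "xs = map w [0..<Suc l] @ [d]"
  have len: "length xs = l + 2" by (simp add: xs_def)
  have nth: "xs ! i = (if i \<le> l then w i else d)" if "i < l + 2" for i
    using that by (auto simp: xs_def nth_append simp del: upt_Suc)
  have "distinct (map w [0..<Suc l])"
    unfolding distinct_map by (auto simp: inj_on_def simp del: upt_Suc) (metis distinct less_Suc_eq_le linorder_neqE_nat)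
  then have "distinct xs"
    using d_neq by (fastforce simp: xs_def less_Suc_eq_le simp del: upt_Suc)
  moreover have "{xs ! i, xs ! j} \<in> H \<longleftrightarrow> j = Suc i mod (l + 2) \<or> i = Suc j mod (l + 2)"
    if ij: "i < l + 2" "j < l + 2" for i j
  proof -
    have S: "Suc k mod (l + 2) = (if k = Suc l then 0 else Suc k)" if "k < l + 2" for k
      using that by simp
    consider "i \<le> l" "j \<le> l" | "i = Suc l" "j \<le> l" | "i \<le> l" "j = Suc l" | "i = Suc l" "j = Suc l"
      using ij by linarith
    then show ?thesis
      by cases (use ij l2 adj_w[of i j] adj_d[of i] adj_d[of j] loopless[of d] in
          \<open>auto simp: S nth insert_commute\<close>)
  qed
  ultimately have "induced_cycle H xs" using l2 by (simp add: induced_cycle_def len)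
  then show False using \<open>chordal H\<close> len l2 by (auto simp: chordal_def)
qed

text \<open>Dirac's theorem. If \<open>A\<close> is not a clique, choose a maximal connected
  \<open>C\<close> for which some vertex outside has no neighbour in it. Let \<open>D\<close> be the
  set of all such vertices and \<open>X\<close> the rest of \<open>A - C\<close>. Then
  \<open>D\<close> is completely joined to \<open>X\<close> and \<open>X\<close> is a clique, so a
  simplicial vertex of \<open>D\<close>, whose neighbours all lie in \<open>D\<close> or
  \<open>X\<close>, is simplicial in \<open>A\<close>.\<close>

lemma chordal_simplicial_vertex:
  assumes loopless: "\<And>v. {v} \<notin> H" and "chordal H" and "finite A" "A \<noteq> {}"
  shows "\<exists>v\<in>A. clique H {u \<in> A. {v, u} \<in> H}"
  using assms(3,4)
proof (induction A rule: finite_psubset_induct)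
  case (psubset A)
  show ?case
  proof (cases "clique H A")
    case True
    obtain v where "v \<in> A" using psubset.prems by blast
    moreover have "clique H {u \<in> A. {v, u} \<in> H}" by (rule clique_subset[OF True]) auto
    ultimately show ?thesis by blast
  next
    case False
    let ?P = "\<lambda>C. C \<subseteq> A \<and> C \<noteq> {} \<and> connected_in H C \<and> (\<exists>d\<in>A - C. \<forall>c\<in>C. {d, c} \<notin> H)"
    from False obtain a b where ab: "a \<in> A" "b \<in> A" "a \<noteq> b" "{a, b} \<notin> H"
      by (auto simp: clique_def)
    then have a: "?P {a}" by (auto simp: connected_in_def insert_commute)
    define Cs where "Cs = {C. ?P C}"
    have "finite Cs"
      by (rule finite_subset[of _ "Pow A"]) (use \<open>finite A\<close> in \<open>auto simp: Cs_def\<close>)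
    moreover have "Cs \<noteq> {}" using a by (auto simp: Cs_def)
    ultimately obtain C where "C \<in> Cs" and maximal: "\<forall>C'\<in>Cs. C \<subseteq> C' \<longrightarrow> C = C'"
      using finite_has_maximal[of Cs] by auto
    then have C: "?P C" by (simp add: Cs_def)
    have max: "C' = C" if "?P C'" "C \<subseteq> C'" for C'
      using maximal that by (auto simp: Cs_def)
    define D where "D = {d \<in> A - C. \<forall>c\<in>C. {d, c} \<notin> H}"
    define X where "X = A - C - D"
    have "D \<noteq> {}" using C by (auto simp: D_def)
    moreover have "D \<subset> A" using C by (auto simp: D_def)
    ultimately obtain v where v: "v \<in> D" "clique H {u \<in> D. {v, u} \<in> H}"
      using psubset.IH by blast
    \<comment> \<open>Otherwise \<open>insert x C\<close> is still connected and still has no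
      neighbour of \<open>d\<close>, against the maximality of \<open>C\<close>.\<close>
    have joined: "{d, x} \<in> H" if "d \<in> D" "x \<in> X" for d x
    proof (rule ccontr)
      assume nadj: "{d, x} \<notin> H"
      from that obtain c where "c \<in> C" "{x, c} \<in> H" by (auto simp: X_def D_def)
      then have "connected_in H (insert x C)"
        using C connected_in_insert[of H C c x] by (auto simp: insert_commute)
      moreover have "d \<in> A - insert x C" using that by (auto simp: X_def D_def)
      moreover have "\<forall>c\<in>insert x C. {d, c} \<notin> H" using that nadj by (auto simp: D_def)
      ultimately have "insert x C = C"
        using C that by (intro max) (auto simp: X_def)
      then show False using that by (auto simp: X_def)
    qed
    \<comment> \<open>Both \<open>x\<close> and \<open>y\<close> have neighbours in
      \<open>C\<close>, while \<open>v\<close> is adjacent to \<open>x\<close> and \<open>y\<close>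
      but to nothing in \<open>C\<close>; so \<open>v\<close> serves as the closing vertex
      \<open>d\<close>.\<close>
    have X: "{x, y} \<in> H" if "x \<in> X" "y \<in> X" "x \<noteq> y" for x y
    proof -
      from that obtain a b where "a \<in> C" "{x, a} \<in> H" "b \<in> C" "{y, b} \<in> H"
        by (auto simp: X_def D_def)
      then show ?thesis
        using that v joined[of v x] joined[of v y] C
        by (intro chordal_separator_adjacent[OF loopless \<open>chordal H\<close>, of C x a y b v])
          (auto simp: X_def D_def)
    qed
    have nbr: "u \<in> D \<union> X" if "u \<in> A" "{v, u} \<in> H" for u
      using that v(1) by (auto simp: D_def X_def)
    have "{s, t} \<in> H" if s: "s \<in> A" "{v, s} \<in> H" and t: "t \<in> A" "{v, t} \<in> H" and "s \<noteq> t" for s t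
    proof -
      have "s \<in> D \<union> X" "t \<in> D \<union> X" using nbr s t by blast+
      then consider "s \<in> D" "t \<in> D" | "s \<in> D" "t \<in> X" | "s \<in> X" "t \<in> D" | "s \<in> X" "t \<in> X" by blast
      then show ?thesis
      proof cases
        case 1
        show ?thesis by (rule cliqueD[OF v(2)]) (use 1 s t \<open>s \<noteq> t\<close> in auto)
      next
        case 3
        then show ?thesis using joined[of t s] by (simp add: insert_commute)
      qed (use joined X \<open>s \<noteq> t\<close> in blast)+
    qed
    then have "clique H {u \<in> A. {v, u} \<in> H}" by (simp add: clique_def)
    moreover have "v \<in> A" using v(1) by (auto simp: D_def)
    ultimately show ?thesis by blast
  qed
qed

text \<open>Every clique through \<open>v\<close> lies in its closed neighbourhood, which is a
  clique because \<open>v\<close> is simplicial. Among the maximal cliques of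
  \<open>A - {v}\<close>, only \<open>N\<close> could be extended by \<open>v\<close>.\<close>

lemma max_cliques_simplicial:
  assumes loopless: "\<And>v. {v} \<notin> H" and "v \<in> A" and N: "N = {u \<in> A. {v, u} \<in> H}" "clique H N"
  shows "max_cliques H A = insert (insert v N) (max_cliques H (A - {v}) - {N})"
proof -
  have "v \<notin> N" using loopless[of v] by (auto simp: N)
  have vN: "clique H (insert v N)"
    using N(2) by (auto simp: clique_def N(1) insert_commute)
  have sub: "K \<subseteq> insert v N" if "clique H K" "K \<subseteq> A" "v \<in> K" for K
    using that by (auto simp: N(1) clique_def)
  show ?thesis
  proof (intro set_eqI iffI)
    fix K assume "K \<in> max_cliques H A"
    then have K: "K \<subseteq> A" "clique H K" "\<And>u. u \<in> A - K \<Longrightarrow> \<not> clique H (insert u K)"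
      by (auto simp: max_cliques_def)
    show "K \<in> insert (insert v N) (max_cliques H (A - {v}) - {N})"
    proof (cases "v \<in> K")
      case True
      have "u \<in> K" if "u \<in> insert v N" for u
      proof (rule ccontr)
        assume "u \<notin> K"
        moreover have "clique H (insert u K)"
          using vN sub[OF K(2,1) True] that by (intro clique_subset[OF vN]) auto
        ultimately show False using K(3)[of u] that \<open>v \<in> A\<close> by (auto simp: N(1))
      qed
      then show ?thesis using sub[OF K(2,1) True] by auto
    next
      case False
      then show ?thesis using K vN \<open>v \<in> A\<close> by (auto simp: max_cliques_def)
    qed
  next
    fix K assume "K \<in> insert (insert v N) (max_cliques H (A - {v}) - {N})"
    then consider "K = insert v N" | "K \<in> max_cliques H (A - {v})" "K \<noteq> N" by blast
    then show "K \<in> max_cliques H A"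
    proof cases
      case 1
      have "\<not> clique H (insert u (insert v N))" if "u \<in> A - insert v N" for u
        using that by (auto simp: clique_def N(1))
      then show ?thesis using 1 vN \<open>v \<in> A\<close> by (auto simp: max_cliques_def N(1))
    next
      case 2
      have "\<not> clique H (insert v K)"
      proof
        assume vK: "clique H (insert v K)"
        have "K \<subseteq> N" using sub[OF vK] 2(1) \<open>v \<in> A\<close> by (auto simp: max_cliques_def)
        with 2(2) obtain u where u: "u \<in> N" "u \<notin> K" by blast
        then have "clique H (insert u K)" using \<open>K \<subseteq> N\<close> by (intro clique_subset[OF N(2)]) auto
        then show False using u 2(1) \<open>v \<notin> N\<close> by (auto simp: max_cliques_def N(1))
      qed
      then show ?thesis using 2(1) by (auto simp: max_cliques_def)
    qed
  qed
qed

text \<open>Eliminate a simplicial vertex \<open>v\<close> and repair the tree for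
  \<open>A - {v}\<close>: the clique \<open>insert v N\<close> either replaces the node
  \<open>N\<close> or is hung as a new leaf on a maximal clique containing \<open>N\<close>.\<close>

lemma clique_tree_of_chordal:
  assumes loopless: "\<And>v. {v} \<notin> H" and "chordal H" and "finite A"
  shows "\<exists>T. clique_tree (max_cliques H A) T"
  using assms(3)
proof (induction A rule: finite_psubset_induct)
  case (psubset A)
  show ?case
  proof (cases "A = {}")
    case True
    then have "max_cliques H A = {{}}" by (auto simp: max_cliques_def clique_def)
    then show ?thesis using join_tree.single by metis
  next
    case False
    then obtain v where v: "v \<in> A" "clique H {u \<in> A. {v, u} \<in> H}"
      using chordal_simplicial_vertex[OF loopless \<open>chordal H\<close> psubset.hyps] by blast
    define N where "N = {u \<in> A. {v, u} \<in> H}"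
    let ?F = "max_cliques H (A - {v})"
    have N: "clique H N" "N \<subseteq> A - {v}" using v(2) loopless[of v] by (auto simp: N_def)
    have eq: "max_cliques H A = insert (insert v N) (?F - {N})"
      using max_cliques_simplicial[OF loopless v(1) N_def N(1)] .
    have "A - {v} \<subset> A" using v by blast
    then obtain T where T: "clique_tree ?F T" using psubset.IH by blast
    have v_notin: "v \<notin> K" if "K \<in> ?F" for K using that by (auto simp: max_cliques_def)
    show ?thesis
    proof (cases "N \<in> ?F")
      case True
      \<comment> \<open>Enlarges the node \<open>N\<close> only. Since \<open>v\<close> lies in no
        other node, intersections of two distinct nodes are unchanged.\<close>
      define g where "g K = (if K = N then insert v K else K)" for K
      have "clique_tree (g ` ?F) ((`) g ` T)"
      proof (rule join_tree_image[OF T])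
        show "inj_on g ?F" using v_notin by (auto simp: inj_on_def g_def split: if_splits)
        show "g K \<inter> g L \<subseteq> g P"
          if "P \<in> ?F" "K \<in> ?F" "L \<in> ?F" "K \<noteq> L" "K \<inter> L \<subseteq> P" for P K L
          using that v_notin by (auto simp: g_def split: if_splits)
      qed
      moreover have "g ` ?F = max_cliques H A"
        using True by (auto simp: eq g_def)
      ultimately show ?thesis by auto
    next
      case False
      obtain P where P: "P \<in> ?F" "N \<subseteq> P"
        using clique_extend[OF _ N(2,1)] psubset.hyps by auto
      \<comment> \<open>The new clique meets every earlier one inside \<open>N\<close>, hence inside
        \<open>P\<close>.\<close>
      have "clique_tree (insert (insert v N) ?F) (insert {insert v N, P} T)"
        using T P v_notin by (intro join_tree.leaf) auto
      then show ?thesis using False eq by auto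
    qed
  qed
qed


section \<open>Monomials\<close>

abbreviation "lookup \<equiv> Poly_Mapping.lookup"
abbreviation "keys \<equiv> Poly_Mapping.keys"
abbreviation "single \<equiv> Poly_Mapping.single"

lemma mdvd_refl [simp]: "mdvd s s"
  by (simp add: mdvd_def)

lemma mdvd_trans: "mdvd s t \<Longrightarrow> mdvd t u \<Longrightarrow> mdvd s u"
  unfolding mdvd_def using order_trans by blast

lemma mdvd_antisym: "mdvd s t \<Longrightarrow> mdvd t s \<Longrightarrow> s = t"
  by (intro poly_mapping_eqI) (auto simp: mdvd_def intro: antisym)

lemma mdvd_diff_add: "mdvd s t \<Longrightarrow> (t - s) + s = t"
  by (intro poly_mapping_eqI) (simp add: lookup_add lookup_minus mdvd_def)

text \<open>Subtraction of exponents truncates at 0, so \<open>s - m\<close> is what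
  \<open>m\<close> still lacks to be a multiple of \<open>s\<close>.\<close>

lemma mdvd_add_iff: "mdvd s (t + m) \<longleftrightarrow> mdvd (s - m) t"
  by (simp add: mdvd_def lookup_add lookup_minus le_diff_conv)

lemma mdvd_add [simp]: "mdvd s (t + s)"
  by (simp add: mdvd_def lookup_add)

lemma mlcm_mdvd_iff: "finite \<sigma> \<Longrightarrow> mdvd (mlcm \<sigma>) t \<longleftrightarrow> (\<forall>m\<in>\<sigma>. mdvd m t)"
  by (auto simp: mdvd_def lookup_mlcm)

lemma mdvd_mlcm: "finite \<sigma> \<Longrightarrow> m \<in> \<sigma> \<Longrightarrow> mdvd m (mlcm \<sigma>)"
  using mlcm_mdvd_iff[of \<sigma> "mlcm \<sigma>"] by simp

lemma mlcm_empty [simp]: "mlcm {} = 0"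
  by (intro poly_mapping_eqI) (simp add: lookup_mlcm)

lemma mlcm_singleton [simp]: "mlcm {m} = m"
  by (intro poly_mapping_eqI) (simp add: lookup_mlcm)

lemma mlcm_insert_redundant:
  assumes "finite \<sigma>" "mdvd m (mlcm \<sigma>)"
  shows "mlcm (insert m \<sigma>) = mlcm \<sigma>"
  using assms by (intro mdvd_antisym) (auto simp: mlcm_mdvd_iff mdvd_mlcm)

lemma mono_poly_mult: "mono_poly s * mono_poly t = mono_poly (s + t)"
  by (simp add: mono_poly_def mult_single)

lemma poly_mapping_sum_single: "p = (\<Sum>t\<in>keys p. single t (lookup p t))"
  by (intro poly_mapping_eqI) (auto simp: lookup_sum lookup_single when_def in_keys_iff)

lemma lookup_mult_mono_poly:
  "lookup (p * mono_poly s) u = (if mdvd s u then lookup p (u - s) else 0)"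
proof -
  have "p * mono_poly s = (\<Sum>t\<in>keys p. single t (lookup p t)) * mono_poly s"
    using poly_mapping_sum_single[of p] by simp
  then have "p * mono_poly s = (\<Sum>t\<in>keys p. single (t + s) (lookup p t))"
    by (simp add: sum_distrib_right mono_poly_def mult_single)
  then have "lookup (p * mono_poly s) u = (\<Sum>t\<in>keys p. if t + s = u then lookup p t else 0)"
    by (simp add: lookup_sum lookup_single when_def)
  also have "\<dots> = (\<Sum>t\<in>keys p. if t = u - s then if mdvd s u then lookup p t else 0 else 0)"
    by (intro sum.cong) (auto simp: mdvd_diff_add)
  also have "\<dots> = (if mdvd s u then lookup p (u - s) else 0)"
    by (auto simp: in_keys_iff)
  finally show ?thesis .
qed

lemma mult_mono_poly_eq_0: "p * mono_poly s = 0 \<Longrightarrow> p = 0"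
proof (intro poly_mapping_eqI)
  fix t assume "p * mono_poly s = 0"
  then have "lookup (p * mono_poly s) (t + s) = 0" by simp
  then show "lookup p t = lookup 0 t"
    by (simp add: lookup_mult_mono_poly)
qed

lemma mono_poly_factor:
  assumes "\<And>t. t \<in> keys p \<Longrightarrow> mdvd s t"
  shows "\<exists>q. p = q * mono_poly s"
proof
  have "(\<Sum>t\<in>keys p. single (t - s) (lookup p t)) * mono_poly s = (\<Sum>t\<in>keys p. single t (lookup p t))"
    unfolding sum_distrib_right
    by (rule sum.cong[OF refl]) (simp add: mono_poly_def mult_single mdvd_diff_add assms)
  then show "p = (\<Sum>t\<in>keys p. single (t - s) (lookup p t)) * mono_poly s"
    using poly_mapping_sum_single[of p] by simp
qed

lemma mono_poly_in_irrelevant_ideal: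
  fixes t :: "'v monom"
  assumes "t \<noteq> 0"
  shows "(mono_poly t :: ('v, 'k::field) mpoly) \<in> ideal_gen (range Var)"
proof -
  obtain v where "lookup t v \<noteq> 0"
    using assms by (metis lookup_zero poly_mapping_eqI)
  then have "mdvd (single v 1) t"
    by (auto simp: mdvd_def lookup_single when_def)
  then have "(mono_poly t :: ('v, 'k) mpoly) \<in> ideal_gen (mono_poly ` range (\<lambda>x. single x 1))"
    unfolding mono_poly_in_ideal_gen_iff by blast
  then show ?thesis
    by (simp add: Var_def image_image)
qed


section \<open>Free modules and the Taylor differential\<close>

lemma free_on_zero [simp]: "0 \<in> free_on B"
  by (simp add: free_on_def)

lemma free_on_empty [simp]: "free_on {} = {0}"
  by (auto simp: free_on_def)

lemma free_on_add: "b \<in> free_on B \<Longrightarrow> c \<in> free_on B \<Longrightarrow> b + c \<in> free_on B"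
  using Poly_Mapping.keys_add[of b c] by (auto simp: free_on_def)

lemma free_on_diff: "b \<in> free_on B \<Longrightarrow> c \<in> free_on B \<Longrightarrow> b - c \<in> free_on B"
  using keys_diff[of b c] by (auto simp: free_on_def)

lemma free_on_scal: "c \<in> free_on B \<Longrightarrow> scal p c \<in> free_on B"
proof -
  have "keys (scal p c) \<subseteq> keys c" by (auto simp: in_keys_iff)
  then show "c \<in> free_on B \<Longrightarrow> scal p c \<in> free_on B" by (auto simp: free_on_def)
qed

lemma free_on_sum: "(\<And>x. x \<in> A \<Longrightarrow> f x \<in> free_on B) \<Longrightarrow> sum f A \<in> free_on B"
  by (induction A rule: infinite_finite_induct) (auto intro: free_on_add)

lemma free_on_single: "b \<in> B \<Longrightarrow> single b p \<in> free_on B"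
  by (auto simp: free_on_def)

lemma free_on_mono: "B \<subseteq> B' \<Longrightarrow> c \<in> free_on B \<Longrightarrow> c \<in> free_on B'"
  by (auto simp: free_on_def)

lemma free_on_lookup: "c \<in> free_on B \<Longrightarrow> b \<notin> B \<Longrightarrow> lookup c b = 0"
  by (auto simp: free_on_def in_keys_iff)

lemma free_on_deleteI: "c \<in> free_on (insert b B) \<Longrightarrow> lookup c b = 0 \<Longrightarrow> c \<in> free_on B"
  by (auto simp: free_on_def in_keys_iff)

lemma free_on_singleton: "c \<in> free_on {b} \<Longrightarrow> c = single b (lookup c b)"
  by (intro poly_mapping_eqI) (auto simp: lookup_single when_def dest: free_on_lookup)

lemma scal_single: "scal p (single b q) = single b (p * q)"
  by (intro poly_mapping_eqI) (simp add: lookup_single when_def)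

lemma scal_scal: "scal p (scal q c) = scal (p * q) c"
  by (intro poly_mapping_eqI) (simp add: mult.assoc)

lemma scal_diff: "scal p (b - c) = scal p b - scal p c"
  by (intro poly_mapping_eqI) (simp add: lookup_minus algebra_simps)

lemma scal_zero [simp]: "scal p 0 = 0" "scal 0 c = 0"
  by (intro poly_mapping_eqI; simp)+

lemma scal_1 [simp]: "scal 1 c = c"
  by (intro poly_mapping_eqI) simp

section \<open>The Taylor differential on vertices and edges\<close>

lemma taylor_diff_superset:
  assumes "finite A" "c \<in> free_on A"
  shows "taylor_diff ms c = (\<Sum>\<sigma>\<in>A. scal (lookup c \<sigma>) (taylor_boundary ms \<sigma>))"
  unfolding taylor_diff_def
  by (rule sum.mono_neutral_left) (use assms in \<open>auto simp: in_keys_iff free_on_def\<close>)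

lemma taylor_diff_single: "taylor_diff ms (single \<sigma> p) = scal p (taylor_boundary ms \<sigma>)"
  using taylor_diff_superset[of "{\<sigma>}" "single \<sigma> p" ms] by (simp add: free_on_single)

lemmas taylor_diff_add = module_hom.add[OF module_hom_taylor_diff]
lemmas taylor_diff_diff = module_hom.diff[OF module_hom_taylor_diff]
lemmas taylor_diff_scal = module_hom.scale[OF module_hom_taylor_diff]
lemmas taylor_diff_zero = module_hom.zero[OF module_hom_taylor_diff]

lemma taylor_diff_sum: "taylor_diff ms (sum f A) = (\<Sum>x\<in>A. taylor_diff ms (f x))"
  by (induction A rule: infinite_finite_induct) (simp_all add: taylor_diff_zero taylor_diff_add)

lemma taylor_boundary_vertex:
  assumes "distinct ms" "m \<in> set ms"
  shows "taylor_boundary ms {m} = single {} (mono_poly m)"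
proof -
  have "l = [m]" if l: "set l = {m}" "distinct l" for l
  proof -
    have "length l = card (set l)" using l(2) by (simp add: distinct_card)
    then obtain a where "l = [a]" using l(1) by (auto simp: length_Suc_conv)
    then show ?thesis using l(1) by simp
  qed
  from this[of "filter (\<lambda>x. x \<in> {m}) ms"] have "filter (\<lambda>x. x \<in> {m}) ms = [m]"
    using assms by fastforce
  then show ?thesis unfolding taylor_boundary_def by simp
qed

text \<open>The sign \<open>s\<close> records which of \<open>x\<close> and \<open>y\<close> comes
  first in \<open>ms\<close>; isolating it makes the formula symmetric for later use.\<close>

lemma taylor_boundary_edge:
  fixes ms :: "'v::finite monom list"
  assumes "distinct ms" "x \<in> set ms" "y \<in> set ms" "x \<noteq> y"
  shows "\<exists>s\<in>{1, -1}. (taylor_boundary ms {x, y} :: 'v monom set \<Rightarrow>\<^sub>0 ('v, 'k::field) mpoly) =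
    scal s (single {x} (mono_poly (mlcm {x, y} - x)) - single {y} (mono_poly (mlcm {x, y} - y)))"
proof -
  have diff: "{x, y} - {x} = {y}" "{x, y} - {y} = {x}" using assms(4) by auto
  let ?e = "\<lambda>z. single {z} (mono_poly (mlcm {x, y} - z)) :: 'v monom set \<Rightarrow>\<^sub>0 ('v, 'k::field) mpoly"
  have "l = [x, y] \<or> l = [y, x]" if "set l = {x, y}" "distinct l" for l
  proof -
    have "length l = 2" using that distinct_card[of l] assms(4) by simp
    then obtain a b where "l = [a, b]" by (auto simp: length_Suc_conv numeral_2_eq_2)
    then show ?thesis using that by (auto simp: doubleton_eq_iff)
  qed
  from this[of "filter (\<lambda>z. z \<in> {x, y}) ms"]
  consider (xy) "filter (\<lambda>z. z \<in> {x, y}) ms = [x, y]" | (yx) "filter (\<lambda>z. z \<in> {x, y}) ms = [y, x]"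
    using assms by fastforce
  then show ?thesis
  proof cases
    case xy
    have "taylor_boundary ms {x, y} = scal (-1) (?e x - ?e y)"
      unfolding taylor_boundary_def xy Let_def
      by (simp add: diff lessThan_Suc scal_diff scal_single single_uminus)
    then show ?thesis by blast
  next
    case yx
    have "taylor_boundary ms {x, y} = scal 1 (?e x - ?e y)"
      unfolding taylor_boundary_def yx Let_def
      by (simp add: diff lessThan_Suc scal_diff scal_single single_uminus)
    then show ?thesis by blast
  qed
qed


section \<open>The Scarf complex of a monomial ideal\<close>

abbreviation between :: "'v::finite monom \<Rightarrow> 'v monom \<Rightarrow> 'v monom \<Rightarrow> bool" where
  "between p m q \<equiv> mdvd p (mlcm {m, q})"

definition scarf_edges :: "('v::finite, 'k::field) mpoly set \<Rightarrow> 'v monom set set" where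
  "scarf_edges I = {\<sigma> \<in> scarf_complex I. card \<sigma> = 2}"

lemma scarf_complexD:
  assumes "\<sigma> \<in> scarf_complex I" "\<tau> \<subseteq> mingens I" "mlcm \<tau> = mlcm \<sigma>"
  shows "\<tau> = \<sigma>"
proof (rule ccontr)
  assume "\<tau> \<noteq> \<sigma>"
  then have "mlcm \<sigma> \<noteq> mlcm \<tau>" using assms(1,2) by (simp add: scarf_complex_def)
  then show False using assms(3) by simp
qed

text \<open>The exponent vector \<open>0\<close> is the monomial 1, so \<open>proper\<close>
  excludes the unit ideal. The list \<open>ms\<close> is fixed here because the signs of the
  differential depend on it.\<close>

locale monomial_ideal =
  fixes I :: "('v::finite, 'k::field) mpoly set" and ms :: "'v monom list"
  assumes distinct_ms: "distinct ms" and set_ms: "set ms = mingens I"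
    and generated: "ideal_gen (mono_poly ` mingens I) = I"
    and proper: "0 \<notin> mingens I" and nonzero: "mingens I \<noteq> {}"
begin

abbreviation d :: "('v monom set \<Rightarrow>\<^sub>0 ('v, 'k) mpoly) \<Rightarrow> ('v monom set \<Rightarrow>\<^sub>0 ('v, 'k) mpoly)" where
  "d \<equiv> taylor_diff ms"

abbreviation bd :: "'v monom set \<Rightarrow> ('v monom set \<Rightarrow>\<^sub>0 ('v, 'k) mpoly)" where
  "bd \<equiv> taylor_boundary ms"

lemma finite_mingens: "finite (mingens I)"
  using set_ms by (metis List.finite_set)

lemma mingens_antichain: "a \<in> mingens I \<Longrightarrow> b \<in> mingens I \<Longrightarrow> mdvd a b \<Longrightarrow> a = b"
  by (simp add: mingens_def)

lemma finite_mingens_subset: "\<sigma> \<subseteq> mingens I \<Longrightarrow> finite \<sigma>"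
  using finite_mingens finite_subset by blast

text \<open>Adjoining \<open>m\<close> would not change the lcm, and a Scarf face is the only set of
  generators with its lcm.\<close>

lemma scarf_complex_absorb:
  assumes "\<sigma> \<in> scarf_complex I" "m \<in> mingens I" "mdvd m (mlcm \<sigma>)"
  shows "m \<in> \<sigma>"
proof -
  have "\<sigma> \<subseteq> mingens I" using assms(1) by (simp add: scarf_complex_def)
  then have "insert m \<sigma> \<subseteq> mingens I" "mlcm (insert m \<sigma>) = mlcm \<sigma>"
    using assms finite_mingens_subset mlcm_insert_redundant by auto
  then have "insert m \<sigma> = \<sigma>"
    using assms(1) scarf_complexD by blast
  then show ?thesis by blast
qed

lemma scarf_complex_0: "{\<sigma> \<in> scarf_complex I. card \<sigma> = 0} = {{}}"
proof -
  have "mlcm {} \<noteq> mlcm \<tau>" if \<tau>: "\<tau> \<subseteq> mingens I" "\<tau> \<noteq> {}" for \<tau>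
  proof
    assume eq: "mlcm {} = mlcm \<tau>"
    obtain m where m: "m \<in> \<tau>" using \<tau> by blast
    then have "mdvd m 0" using mdvd_mlcm[of \<tau> m] eq finite_mingens_subset[OF \<tau>(1)] by simp
    then have "m = 0" by (intro mdvd_antisym) (simp_all add: mdvd_def)
    then show False using m \<tau> proper by blast
  qed
  then have "{} \<in> scarf_complex I" by (auto simp: scarf_complex_def)
  moreover have "\<sigma> = {}" if "\<sigma> \<in> scarf_complex I" "card \<sigma> = 0" for \<sigma>
    using that finite_mingens_subset by (auto simp: scarf_complex_def)
  ultimately show ?thesis by auto
qed

lemma scarf_complex_1: "{\<sigma> \<in> scarf_complex I. card \<sigma> = 1} = (\<lambda>m. {m}) ` mingens I"
proof -
  have "{m} \<in> scarf_complex I" if m: "m \<in> mingens I" for m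
  proof -
    have "\<tau> = {m}" if \<tau>: "\<tau> \<subseteq> mingens I" "mlcm {m} = mlcm \<tau>" for \<tau>
    proof -
      have "\<tau> \<noteq> {}" using \<tau>(2) m proper by auto
      moreover have "x = m" if "x \<in> \<tau>" for x
        using mdvd_mlcm[of \<tau> x] that \<tau> finite_mingens_subset mingens_antichain[of x m] m by auto
      ultimately show ?thesis by blast
    qed
    then show ?thesis unfolding scarf_complex_def using m by blast
  qed
  moreover have "\<sigma> \<in> (\<lambda>m. {m}) ` mingens I" if \<sigma>: "\<sigma> \<in> scarf_complex I" "card \<sigma> = 1" for \<sigma>
  proof -
    obtain m where "\<sigma> = {m}" using \<sigma>(2) by (rule card_1_singletonE)
    then show ?thesis using \<sigma>(1) by (simp add: scarf_complex_def)
  qed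
  moreover have "card {m} = 1" for m :: "'v monom" by simp
  ultimately show ?thesis by blast
qed

text \<open>For the converse, a set with the same lcm consists of divisors of it and hence lies in
  \<open>{x, y}\<close>. A proper subset would make one minimal generator divide another.\<close>

lemma scarf_edge_iff:
  assumes "x \<in> mingens I" "y \<in> mingens I" "x \<noteq> y"
  shows "{x, y} \<in> scarf_edges I \<longleftrightarrow> (\<forall>z\<in>mingens I. between z x y \<longrightarrow> z \<in> {x, y})"
proof
  assume "{x, y} \<in> scarf_edges I"
  then show "\<forall>z\<in>mingens I. between z x y \<longrightarrow> z \<in> {x, y}"
    using scarf_complex_absorb by (auto simp: scarf_edges_def)
next
  assume *: "\<forall>z\<in>mingens I. between z x y \<longrightarrow> z \<in> {x, y}"
  have "\<tau> = {x, y}" if \<tau>: "\<tau> \<subseteq> mingens I" "mlcm {x, y} = mlcm \<tau>" for \<tau>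
  proof (rule ccontr)
    assume "\<tau> \<noteq> {x, y}"
    have "\<tau> \<subseteq> {x, y}"
      using * \<tau> mdvd_mlcm[OF finite_mingens_subset[OF \<tau>(1)]] by auto
    with \<open>\<tau> \<noteq> {x, y}\<close> obtain a b where ab: "\<tau> \<subseteq> {a}" "b \<notin> \<tau>" "{x, y} = {a, b}" by blast
    then have "mdvd (mlcm \<tau>) a"
      using finite_mingens_subset[OF \<tau>(1)] by (auto simp: mlcm_mdvd_iff)
    moreover have "mdvd b (mlcm \<tau>)"
      using mdvd_mlcm[of "{x, y}" b] ab \<tau>(2) by auto
    ultimately have "mdvd b a" using mdvd_trans by blast
    then show False using mingens_antichain[of b a] ab(3) assms by (auto simp: doubleton_eq_iff)
  qed
  then show "{x, y} \<in> scarf_edges I"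
    using assms by (auto simp: scarf_edges_def scarf_complex_def)
qed

lemma scarf_edgeE:
  assumes "e \<in> scarf_edges I"
  obtains x y where "x \<in> mingens I" "y \<in> mingens I" "x \<noteq> y" "e = {x, y}"
  using assms by (auto simp: scarf_edges_def scarf_complex_def card_2_iff)

lemma finite_scarf_edges: "finite (scarf_edges I)"
  using finite_mingens
  by (intro finite_subset[of "scarf_edges I" "Pow (mingens I)"]) (auto simp: scarf_edges_def scarf_complex_def)


section \<open>The Scarf subcomplex in low degrees\<close>

lemma bd_vertex: "m \<in> mingens I \<Longrightarrow> bd {m} = single {} (mono_poly m)"
  using taylor_boundary_vertex[OF distinct_ms] set_ms by simp

text \<open>Here \<open>s\<close> is 1 or -1. The equation \<open>s * s = 1\<close> is used to
  cancel signs, the nonzero constant coefficient to evaluate \<open>cut_sum\<close>.\<close>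

lemma bd_edge:
  assumes "x \<in> mingens I" "y \<in> mingens I" "x \<noteq> y"
  obtains s where "s * s = 1" "lookup s 0 \<noteq> 0"
    "bd {x, y} = scal s (single {x} (mono_poly (mlcm {x, y} - x)) - single {y} (mono_poly (mlcm {x, y} - y)))"
proof -
  obtain s where "s \<in> {1, -1}"
    "bd {x, y} = scal s (single {x} (mono_poly (mlcm {x, y} - x)) - single {y} (mono_poly (mlcm {x, y} - y)))"
    using taylor_boundary_edge[OF distinct_ms, of x y] assms set_ms by blast
  then show thesis by (intro that[of s]) auto
qed

lemma d_vertices:
  assumes "F \<subseteq> mingens I" "c \<in> free_on ((\<lambda>m. {m}) ` F)"
  shows "d c = single {} (\<Sum>m\<in>F. lookup c {m} * mono_poly m)"
proof -
  have "d c = (\<Sum>\<sigma>\<in>(\<lambda>m. {m}) ` F. scal (lookup c \<sigma>) (bd \<sigma>))"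
    using assms finite_mingens_subset by (intro taylor_diff_superset) auto
  also have "\<dots> = (\<Sum>m\<in>F. scal (lookup c {m}) (bd {m}))"
    by (subst sum.reindex) (auto simp: inj_on_def)
  also have "\<dots> = (\<Sum>m\<in>F. single {} (lookup c {m} * mono_poly m))"
    using assms(1) by (intro sum.cong) (auto simp: bd_vertex scal_single)
  also have "\<dots> = single {} (\<Sum>m\<in>F. lookup c {m} * mono_poly m)"
    by (intro poly_mapping_eqI) (auto simp: lookup_sum lookup_single when_def)
  finally show ?thesis .
qed

lemma vertex_cycle_relation:
  assumes "F \<subseteq> mingens I" "c \<in> free_on ((\<lambda>m. {m}) ` F)" "d c = 0"
  shows "(\<Sum>m\<in>F. lookup c {m} * mono_poly m) = 0"
proof -
  have "lookup (d c) {} = (\<Sum>m\<in>F. lookup c {m} * mono_poly m)"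
    by (simp add: d_vertices[OF assms(1,2)])
  then show ?thesis using assms(3) by simp
qed

lemma bd_edge_vertices:
  "x \<in> mingens I \<Longrightarrow> y \<in> mingens I \<Longrightarrow> x \<noteq> y \<Longrightarrow> x \<in> F \<Longrightarrow> y \<in> F \<Longrightarrow>
    bd {x, y} \<in> free_on ((\<lambda>m. {m}) ` F)"
  by (erule (2) bd_edge) (auto intro!: free_on_scal free_on_diff free_on_single)

lemma d_bd_edge:
  assumes "x \<in> mingens I" "y \<in> mingens I" "x \<noteq> y"
  shows "d (bd {x, y}) = 0"
proof -
  obtain s where s: "bd {x, y} = scal s (single {x} (mono_poly (mlcm {x, y} - x)) - single {y} (mono_poly (mlcm {x, y} - y)))"
    using bd_edge[OF assms] by metis
  have "(mlcm {x, y} - x) + x = mlcm {x, y}" "(mlcm {x, y} - y) + y = mlcm {x, y}"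
    by (intro mdvd_diff_add mdvd_mlcm; simp)+
  then show ?thesis
    using assms unfolding s
    by (simp add: taylor_diff_scal taylor_diff_diff taylor_diff_single bd_vertex scal_single mono_poly_mult)
qed

lemma d_edges_vertices:
  assumes "T \<subseteq> scarf_edges I" "c \<in> free_on T"
  shows "d c \<in> free_on ((\<lambda>m. {m}) ` mingens I)" and "d (d c) = 0"
proof -
  have fin: "finite T" using assms(1) finite_scarf_edges finite_subset by blast
  have dc: "d c = (\<Sum>\<sigma>\<in>T. scal (lookup c \<sigma>) (bd \<sigma>))"
    by (rule taylor_diff_superset[OF fin assms(2)])
  have edge: "bd \<sigma> \<in> free_on ((\<lambda>m. {m}) ` mingens I) \<and> d (bd \<sigma>) = 0" if "\<sigma> \<in> T" for \<sigma>
    using subsetD[OF assms(1) that] by (rule scarf_edgeE) (simp add: bd_edge_vertices d_bd_edge)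
  show "d c \<in> free_on ((\<lambda>m. {m}) ` mingens I)"
    unfolding dc using edge by (intro free_on_sum free_on_scal) blast
  show "d (d c) = 0"
    unfolding dc taylor_diff_sum taylor_diff_scal using edge by simp
qed

text \<open>Compare coefficients at \<open>t + m\<close> in the relation given by the cycle: the
  term from \<open>m\<close> must be cancelled by one from some \<open>q\<close> in \<open>F\<close>
  dividing \<open>t + m\<close>. So the lcm of \<open>m\<close> and \<open>q\<close> divides
  \<open>t + m\<close>, and with it \<open>p\<close> does.\<close>

lemma cycle_coefficient_dvd:
  assumes F: "F \<subseteq> mingens I" "m \<in> mingens I" "m \<notin> F"
    and p: "p \<in> mingens I" "\<And>q. q \<in> F \<Longrightarrow> between p m q"
    and c: "c \<in> free_on ((\<lambda>m. {m}) ` insert m F)" "d c = 0"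
  shows "\<exists>r. lookup c {m} = r * mono_poly (mlcm {m, p} - m)"
proof (rule mono_poly_factor)
  fix t assume t: "t \<in> keys (lookup c {m})"
  have fin: "finite F" using F(1) finite_mingens_subset by blast
  have "(\<Sum>q\<in>insert m F. lookup c {q} * mono_poly q) = 0"
    using F c by (intro vertex_cycle_relation) auto
  then have "lookup c {m} * mono_poly m + (\<Sum>q\<in>F. lookup c {q} * mono_poly q) = 0"
    using fin F(3) by simp
  from arg_cong[OF this, of "\<lambda>x. lookup x (t + m)"]
  have "lookup (lookup c {m} * mono_poly m) (t + m) + lookup (\<Sum>q\<in>F. lookup c {q} * mono_poly q) (t + m) = 0"
    by (simp only: lookup_add lookup_zero)
  moreover have "lookup (lookup c {m} * mono_poly m) (t + m) \<noteq> 0"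
    using t by (simp add: lookup_mult_mono_poly in_keys_iff)
  ultimately have "(\<Sum>q\<in>F. lookup (lookup c {q} * mono_poly q) (t + m)) \<noteq> 0"
    by (auto simp: lookup_sum)
  then obtain q where "q \<in> F" "lookup (lookup c {q} * mono_poly q) (t + m) \<noteq> 0"
    by (meson sum.neutral)
  then have q: "q \<in> F" "mdvd q (t + m)" by (auto simp: lookup_mult_mono_poly split: if_splits)
  then have "mdvd (mlcm {m, q}) (t + m)" by (simp add: mlcm_mdvd_iff)
  then have "mdvd (mlcm {m, p}) (t + m)"
    using mdvd_trans[OF p(2)[OF q(1)]] by (simp add: mlcm_mdvd_iff)
  then show "mdvd (mlcm {m, p} - m) t" by (simp add: mdvd_add_iff)
qed

text \<open>By the preceding divisibility a multiple of the boundary of \<open>{m, p}\<close>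
  cancels the coefficient at the leaf \<open>m\<close>; what remains is a cycle on the smaller
  tree.\<close>

lemma join_tree_exact_vertices:
  assumes "join_tree between F T" "F \<subseteq> mingens I"
    and "c \<in> free_on ((\<lambda>m. {m}) ` F)" "d c = 0"
  shows "c \<in> d ` free_on T"
  using assms
proof (induction arbitrary: c rule: join_tree.induct)
  case (single m)
  have "lookup c {m} * mono_poly m = 0"
    using vertex_cycle_relation[OF single.prems] by simp
  then have "lookup c {m} = 0" by (rule mult_mono_poly_eq_0)
  then have "c = 0" using free_on_singleton[of c "{m}"] single.prems(2) by simp
  then show ?case using taylor_diff_zero[of ms] by (auto simp: image_iff)
next
  case (leaf F T m p)
  have mp: "m \<in> mingens I" "p \<in> mingens I" "m \<noteq> p" "F \<subseteq> mingens I" using leaf by auto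
  obtain r where r: "lookup c {m} = r * mono_poly (mlcm {m, p} - m)"
    using cycle_coefficient_dvd[of F m p c] leaf.hyps leaf.prems mp by blast
  obtain s where s: "s * s = 1"
    "bd {m, p} = scal s (single {m} (mono_poly (mlcm {m, p} - m)) - single {p} (mono_poly (mlcm {m, p} - p)))"
    using bd_edge[OF mp(1-3)] by metis
  \<comment> \<open>The factor \<open>s\<close> undoes the sign in the boundary of the edge.\<close>
  define b where "b = single {m, p} (r * s)"
  have db: "d b = scal (r * s) (bd {m, p})" by (simp add: b_def taylor_diff_single)
  have "d b = scal r (single {m} (mono_poly (mlcm {m, p} - m)) - single {p} (mono_poly (mlcm {m, p} - p)))"
    unfolding db s(2) scal_scal mult.assoc s(1) mult_1_right ..
  then have "lookup (d b) {m} = lookup c {m}"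
    using mp(3) by (simp add: r lookup_minus lookup_single)
  moreover have "d b \<in> free_on ((\<lambda>m. {m}) ` insert m F)"
    unfolding db using mp leaf.hyps(3) by (intro free_on_scal bd_edge_vertices) auto
  then have "c - d b \<in> free_on (insert {m} ((\<lambda>m. {m}) ` F))"
    using free_on_diff[OF leaf.prems(2)] by simp
  ultimately have "c - d b \<in> free_on ((\<lambda>m. {m}) ` F)"
    by (rule_tac free_on_deleteI[of _ "{m}"]) (simp_all add: lookup_minus)
  moreover have "d (c - d b) = 0"
    using leaf.prems(3) mp by (simp add: taylor_diff_diff db taylor_diff_scal d_bd_edge)
  ultimately obtain b' where "b' \<in> free_on T" "c - d b = d b'"
    using leaf.IH mp(4) by blast
  then have "c = d (b' + b)" "b' + b \<in> free_on (insert {m, p} T)"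
    by (auto simp: taylor_diff_add b_def algebra_simps intro!: free_on_add free_on_single elim: free_on_mono[rotated])
  then show ?case by blast
qed

text \<open>Only the edge \<open>{m, p}\<close> reaches the leaf \<open>m\<close>, so its
  coefficient vanishes first. The shape of the tree decides, whence the arbitrary
  \<open>R\<close>.\<close>

lemma join_tree_inj_edges:
  assumes "join_tree R F T" "F \<subseteq> mingens I" and "c \<in> free_on T" "d c = 0"
  shows "c = 0"
  using assms
proof (induction rule: join_tree.induct)
  case (single m)
  then show ?case by simp
next
  case (leaf F T m p)
  have mp: "m \<in> mingens I" "p \<in> mingens I" "m \<noteq> p" "F \<subseteq> mingens I" using leaf by auto
  have fin: "finite T" and notin: "{m, p} \<notin> T"
    using join_tree_finite[OF leaf.hyps(1)] join_tree_edge_subset[OF leaf.hyps(1)] leaf.hyps(2) by blast+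
  obtain s where s: "s * s = 1"
    "bd {m, p} = scal s (single {m} (mono_poly (mlcm {m, p} - m)) - single {p} (mono_poly (mlcm {m, p} - p)))"
    using bd_edge[OF mp(1-3)] by metis
  have other: "lookup (bd e) {m} = 0" if e: "e \<in> T" for e
  proof -
    obtain x y where "x \<in> F" "y \<in> F" "x \<noteq> y" "e = {x, y}"
      using join_tree_edgeE[OF leaf.hyps(1) e] by blast
    then show ?thesis
      using bd_edge_vertices[of x y F] mp(4) leaf.hyps(2) by (intro free_on_lookup[of _ "(\<lambda>m. {m}) ` F"]) auto
  qed
  have "lookup (d c) {m} = (\<Sum>e\<in>insert {m, p} T. lookup c e * lookup (bd e) {m})"
    using leaf.prems(2) fin by (subst taylor_diff_superset[of "insert {m, p} T"]) (auto simp: lookup_sum)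
  also have "\<dots> = lookup c {m, p} * lookup (bd {m, p}) {m}"
    using fin notin other by simp
  also have "\<dots> = lookup c {m, p} * s * mono_poly (mlcm {m, p} - m)"
    using mp(3) by (simp add: s(2) lookup_minus lookup_single when_def mult.assoc)
  finally have "lookup c {m, p} * s = 0" using leaf.prems(3) mult_mono_poly_eq_0 by simp
  then have "lookup c {m, p} * s * s = 0" by simp
  then have "lookup c {m, p} = 0" using s(1) by (simp add: mult.assoc)
  then have "c \<in> free_on T" by (rule free_on_deleteI[OF leaf.prems(2)])
  then show ?case using leaf.IH leaf.prems mp by blast
qed

lemma d_vertices_image:
  "d ` free_on ((\<lambda>m. {m}) ` mingens I) = {c \<in> free_on {{}}. lookup c {} \<in> I}"
proof (intro set_eqI iffI)
  interpret M: module "(*) :: ('v, 'k) mpoly \<Rightarrow> _" by (rule module_mult)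
  fix c :: "'v monom set \<Rightarrow>\<^sub>0 ('v, 'k) mpoly" assume "c \<in> d ` free_on ((\<lambda>m. {m}) ` mingens I)"
  then obtain b where b: "c = single {} (\<Sum>m\<in>mingens I. lookup b {m} * mono_poly m)"
    using d_vertices by blast
  have "(\<Sum>m\<in>mingens I. lookup b {m} * mono_poly m) \<in> ideal_gen (mono_poly ` mingens I)"
    unfolding ideal_gen_def by (intro M.span_sum M.span_scale M.span_base) auto
  then show "c \<in> {c \<in> free_on {{}}. lookup c {} \<in> I}"
    using generated b by (simp add: free_on_single)
next
  interpret M: module "(*) :: ('v, 'k) mpoly \<Rightarrow> _" by (rule module_mult)
  let ?im = "d ` free_on ((\<lambda>m. {m}) ` mingens I)"
  fix c :: "'v monom set \<Rightarrow>\<^sub>0 ('v, 'k) mpoly" assume "c \<in> {c \<in> free_on {{}}. lookup c {} \<in> I}"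
  then have c: "c = single {} (lookup c {})" "lookup c {} \<in> M.span (mono_poly ` mingens I)"
    using free_on_singleton generated by (auto simp: ideal_gen_def)
  have "single {} p \<in> ?im" if "p \<in> M.span (mono_poly ` mingens I)" for p
    using that
  proof (induction p rule: M.span_induct_alt)
    case base
    show ?case using taylor_diff_zero[of ms] by (auto simp: image_iff intro!: bexI[of _ 0])
  next
    case (step q x y)
    then obtain m b where m: "m \<in> mingens I" "x = mono_poly m"
      and b: "b \<in> free_on ((\<lambda>m. {m}) ` mingens I)" "single {} y = d b"
      by auto
    have "single {} (q * x + y) = d (single {m} q + b)"
      using m by (simp add: taylor_diff_add taylor_diff_single bd_vertex scal_single single_add b)
    moreover have "single {m} q + b \<in> free_on ((\<lambda>m. {m}) ` mingens I)"
      using m b by (intro free_on_add free_on_single) auto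
    ultimately show ?case by blast
  qed
  then show "c \<in> ?im" using c by metis
qed

text \<open>This gives minimality: no coefficient is a unit, because a generator is not 1 and two
  distinct minimal generators do not divide each other.\<close>

lemma d_in_irrelevant_ideal:
  assumes "A \<subseteq> (\<lambda>m. {m}) ` mingens I \<union> scarf_edges I" "c \<in> free_on A"
  shows "lookup (d c) b \<in> ideal_gen (range Var)"
proof -
  interpret M: module "(*) :: ('v, 'k) mpoly \<Rightarrow> _" by (rule module_mult)
  have mono: "mono_poly t \<in> M.span (range Var)" if "t \<noteq> 0" for t :: "'v monom"
    using mono_poly_in_irrelevant_ideal[OF that] by (simp add: ideal_gen_def)
  have "lookup (bd \<sigma>) b \<in> M.span (range Var)" if "\<sigma> \<in> A" for \<sigma>
  proof -
    from that assms(1) consider m where "m \<in> mingens I" "\<sigma> = {m}" | "\<sigma> \<in> scarf_edges I" by blast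
    then show ?thesis
    proof cases
      case 1
      then have "m \<noteq> 0" using proper by blast
      with 1 show ?thesis
        by (auto simp: bd_vertex lookup_single when_def intro: mono M.span_zero)
    next
      case 2
      then obtain x y where xy: "x \<in> mingens I" "y \<in> mingens I" "x \<noteq> y" "\<sigma> = {x, y}"
        by (rule scarf_edgeE)
      have ne: "mlcm {x, y} - z \<noteq> 0" if "z \<in> {x, y}" for z
      proof
        assume "mlcm {x, y} - z = 0"
        then have "mlcm {x, y} = z"
          using mdvd_diff_add[OF mdvd_mlcm[of "{x, y}" z]] that by simp
        then have "mdvd x z" "mdvd y z"
          using mdvd_mlcm[of "{x, y}" x] mdvd_mlcm[of "{x, y}" y] by auto
        then show False using mingens_antichain xy that by blast
      qed
      obtain s where "bd \<sigma> = scal s (single {x} (mono_poly (mlcm {x, y} - x)) - single {y} (mono_poly (mlcm {x, y} - y)))"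
        using bd_edge[OF xy(1-3)] xy(4) by metis
      then show ?thesis
        using xy(3) ne
        by (auto simp: lookup_minus lookup_single when_def intro!: M.span_scale M.span_diff M.span_neg M.span_zero mono)
    qed
  qed
  moreover have "finite A"
    using assms(1) finite_mingens finite_scarf_edges by (meson finite_Un finite_imageI finite_subset)
  ultimately show ?thesis
    unfolding ideal_gen_def using assms(2)
    by (subst taylor_diff_superset[of A]) (auto simp: lookup_sum intro!: M.span_sum M.span_scale)
qed


section \<open>Scarf ideals and join trees\<close>

lemma scarf_edges_subset_join_tree:
  assumes "join_tree between (mingens I) T"
  shows "scarf_edges I \<subseteq> T"
proof
  fix e assume e: "e \<in> scarf_edges I"
  then obtain x y where xy: "x \<in> mingens I" "y \<in> mingens I" "x \<noteq> y" "e = {x, y}"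
    by (rule scarf_edgeE)
  show "e \<in> T"
    unfolding xy(4)
    by (rule join_tree_edgeI[OF assms xy(1-3)])
      (use e xy scarf_edge_iff[OF xy(1-3)] in \<open>auto simp: insert_commute\<close>)
qed

abbreviation scarf_resolves :: bool where
  "scarf_resolves \<equiv> minimal_free_resolution (\<lambda>i. {\<sigma> \<in> scarf_complex I. card \<sigma> = i}) d (\<lambda>c. lookup c {}) I"

lemma scarf_complex_2: "{\<sigma> \<in> scarf_complex I. card \<sigma> = Suc (Suc 0)} = scarf_edges I"
  by (simp add: scarf_edges_def numeral_2_eq_2)

lemma scarf_complex_higher:
  "(\<And>\<sigma>. \<sigma> \<in> scarf_complex I \<Longrightarrow> card \<sigma> \<le> 2) \<Longrightarrow> {\<sigma> \<in> scarf_complex I. card \<sigma> = Suc (Suc (Suc i))} = {}"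
  by fastforce

text \<open>The Scarf edges lie in \<open>T\<close>, which has one edge fewer than there are
  generators. The assumed count turns this inclusion into equality, and exactness can then be read
  off from the tree.\<close>

lemma scarf_resolves_of_join_tree:
  assumes dim: "\<And>\<sigma>. \<sigma> \<in> scarf_complex I \<Longrightarrow> card \<sigma> \<le> 2"
    and tree: "join_tree between (mingens I) T" and card: "card (mingens I) - 1 \<le> card (scarf_edges I)"
  shows scarf_resolves
proof -
  let ?B = "\<lambda>i. {\<sigma> \<in> scarf_complex I. card \<sigma> = i}"
  note B0 = scarf_complex_0 and B1 = scarf_complex_1[unfolded One_nat_def]
    and B2 = scarf_complex_2 and B3 = scarf_complex_higher[OF dim]
  have "scarf_edges I = T"
    using card join_tree_card[OF tree] join_tree_finite[OF tree] scarf_edges_subset_join_tree[OF tree]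
    by (intro card_seteq) auto
  then have tree': "join_tree between (mingens I) (scarf_edges I)" using tree by simp
  have sub: "d ` free_on (?B (Suc i)) \<subseteq> free_on (?B i)" for i
  proof -
    consider "i = 0" | "i = 1" | j where "i = Suc (Suc j)" by (metis One_nat_def not0_implies_Suc)
    then show ?thesis
    proof cases
      case 1
      then show ?thesis using d_vertices_image by (auto simp: B0 B1)
    next
      case 2
      then show ?thesis using d_edges_vertices(1)[OF order_refl] by (auto simp: B1 B2)
    next
      case 3
      then show ?thesis by (simp add: B3 taylor_diff_zero)
    qed
  qed
  have ker: "d ` free_on (?B (Suc (Suc i))) = {c \<in> free_on (?B (Suc i)). d c = 0}" for i
  proof -
    consider "i = 0" | "i = 1" | j where "i = Suc (Suc j)" by (metis One_nat_def not0_implies_Suc)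
    then show ?thesis
    proof cases
      case 1
      then show ?thesis
        using join_tree_exact_vertices[OF tree' order_refl] d_edges_vertices[OF order_refl]
        by (auto simp: B1 B2)
    next
      case 2
      then show ?thesis
        using join_tree_inj_edges[OF tree' order_refl] by (auto simp: B2 B3 taylor_diff_zero)
    next
      case 3
      then show ?thesis by (auto simp: B3 taylor_diff_zero)
    qed
  qed
  have aug: "\<exists>c\<in>free_on (?B 0). q - lookup c {} \<in> I" for q
  proof
    show "single {} q \<in> free_on (?B 0)" by (simp add: B0 free_on_single)
    have "0 \<in> I"
      using generated module.span_zero[OF module_mult] unfolding ideal_gen_def by metis
    then show "q - lookup (single {} q) {} \<in> I" by simp
  qed
  have minimal: "lookup (d c) b \<in> ideal_gen (range Var)" if "c \<in> free_on (?B (Suc i))" for c i b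
  proof -
    \<comment> \<open>The values 0 and 1 of \<open>i\<close> give vertices and edges; beyond them
      the basis is empty by \<open>dim\<close>.\<close>
    have "?B (Suc i) \<subseteq> (\<lambda>m. {m}) ` mingens I \<union> scarf_edges I"
      by (cases i rule: nat.exhaust; cases "i - 1") (auto simp: B1 B2 B3)
    then show ?thesis using that by (rule d_in_irrelevant_ideal)
  qed
  show ?thesis
    unfolding minimal_free_resolution_def free_resolution_def
    using sub ker aug minimal d_vertices_image
    by (simp add: B0 B1 module_hom_taylor_diff module_hom_lookup)
qed

section \<open>From a Scarf resolution to a join tree: cuts and cycles\<close>

text \<open>
  On the boundary of an edge this functional vanishes unless the edge divides \<open>u\<close> and has exactly
  one end in \<open>C\<close>.
\<close>

definition cut_sum :: "'v monom set \<Rightarrow> 'v monom \<Rightarrow> ('v monom set \<Rightarrow>\<^sub>0 ('v, 'k) mpoly) \<Rightarrow> 'k" where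
  "cut_sum C u c = (\<Sum>m\<in>{m \<in> mingens I. m \<in> C \<and> mdvd m u}. lookup (lookup c {m}) (u - m))"

lemma cut_sum_sum: "cut_sum C u (sum f A) = (\<Sum>x\<in>A. cut_sum C u (f x))"
  unfolding cut_sum_def by (simp add: lookup_sum) (rule sum.swap)

lemma cut_sum_diff: "cut_sum C u (b - c) = cut_sum C u b - cut_sum C u c"
  unfolding cut_sum_def by (simp add: lookup_minus sum_subtractf)

lemma cut_sum_single:
  assumes "m \<in> mingens I"
  shows "cut_sum C u (single {m} p) = (if m \<in> C \<and> mdvd m u then lookup p (u - m) else 0)"
proof -
  have "cut_sum C u (single {m} p) =
      (\<Sum>m'\<in>{m \<in> mingens I. m \<in> C \<and> mdvd m u}. if m' = m then lookup p (u - m) else 0)"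
    unfolding cut_sum_def by (intro sum.cong) (auto simp: lookup_single when_def)
  then show ?thesis using assms finite_mingens by simp
qed

text \<open>The value depends on \<open>m\<close> only through membership in \<open>C\<close>. Hence
  the two ends of an edge with lcm \<open>l\<close> cancel when both lie in
  \<open>C\<close>.\<close>

lemma cut_sum_single_mono:
  assumes "m \<in> mingens I" "mdvd m l"
  shows "cut_sum C u (single {m} (p * mono_poly (l - m))) = (if m \<in> C \<and> mdvd l u then lookup p (u - l) else 0)"
proof (cases "mdvd m u")
  case True
  have "mdvd (l - m) (u - m) \<longleftrightarrow> mdvd l u"
    using True by (simp add: mdvd_add_iff[symmetric] mdvd_diff_add)
  moreover have "(u - m) - (l - m) = u - l"
    using assms(2) True by (intro poly_mapping_eqI) (simp add: lookup_minus mdvd_def)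
  ultimately show ?thesis using assms True by (simp add: cut_sum_single lookup_mult_mono_poly)
next
  case False
  then show ?thesis using assms mdvd_trans by (auto simp: cut_sum_single)
qed

lemma cut_sum_edge:
  assumes "x \<in> mingens I" "y \<in> mingens I" "x \<noteq> y"
  obtains s where "lookup s 0 \<noteq> 0" "\<And>C u p. cut_sum C u (scal p (bd {x, y})) =
    (if mdvd (mlcm {x, y}) u then (of_bool (x \<in> C) - of_bool (y \<in> C)) * lookup (p * s) (u - mlcm {x, y}) else 0)"
proof -
  obtain s where s: "lookup s 0 \<noteq> 0"
    "bd {x, y} = scal s (single {x} (mono_poly (mlcm {x, y} - x)) - single {y} (mono_poly (mlcm {x, y} - y)))"
    using bd_edge[OF assms] by metis
  show thesis
  proof (rule that[OF s(1)])
    fix C u p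
    have "scal p (bd {x, y}) = single {x} ((p * s) * mono_poly (mlcm {x, y} - x)) - single {y} ((p * s) * mono_poly (mlcm {x, y} - y))"
      by (simp add: s(2) scal_scal scal_diff scal_single mult.assoc)
    then show "cut_sum C u (scal p (bd {x, y})) =
      (if mdvd (mlcm {x, y}) u then (of_bool (x \<in> C) - of_bool (y \<in> C)) * lookup (p * s) (u - mlcm {x, y}) else 0)"
      using assms by (simp add: cut_sum_diff cut_sum_single_mono mdvd_mlcm)
  qed
qed

text \<open>The Taylor boundary of \<open>{x, y}\<close> is a cycle of vertices even if
  \<open>{x, y}\<close> is not a Scarf edge, so exactness writes it in terms of Scarf edges. Without
  a crossing edge below \<open>u\<close>, \<open>cut_sum C u\<close> kills all of those, yet it
  separates \<open>x\<close> from \<open>y\<close>.\<close>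

lemma scarf_cut:
  assumes exact: "d ` free_on (scarf_edges I) = {c \<in> free_on ((\<lambda>m. {m}) ` mingens I). d c = 0}"
    and xy: "x \<in> C" "x \<in> mingens I" "y \<in> mingens I" "y \<notin> C"
  shows "\<exists>a b. {a, b} \<in> scarf_edges I \<and> a \<in> C \<and> b \<notin> C \<and> between a x y \<and> between b x y"
proof (rule ccontr)
  assume none: "\<not> ?thesis"
  define u where "u = mlcm {x, y}"
  have "x \<noteq> y" using xy by blast
  have "bd {x, y} \<in> d ` free_on (scarf_edges I)"
    unfolding exact using xy \<open>x \<noteq> y\<close> by (simp add: bd_edge_vertices d_bd_edge)
  then obtain c where c: "c \<in> free_on (scarf_edges I)" "bd {x, y} = d c" by blast
  have zero: "cut_sum C u (scal p (bd e)) = 0" if e: "e \<in> scarf_edges I" for e p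
  proof (rule ccontr)
    assume ne: "cut_sum C u (scal p (bd e)) \<noteq> 0"
    obtain a b where ab: "a \<in> mingens I" "b \<in> mingens I" "a \<noteq> b" "e = {a, b}"
      using e by (rule scarf_edgeE)
    obtain s where "cut_sum C u (scal p (bd {a, b})) =
      (if mdvd (mlcm {a, b}) u then (of_bool (a \<in> C) - of_bool (b \<in> C)) * lookup (p * s) (u - mlcm {a, b}) else 0)"
      using cut_sum_edge[OF ab(1-3)] by metis
    then have "mdvd (mlcm {a, b}) u" "a \<in> C \<longleftrightarrow> b \<notin> C"
      using ne ab(4) by (auto split: if_splits)
    moreover have "{a, b} \<in> scarf_edges I" "{b, a} \<in> scarf_edges I"
      using e ab(4) by (simp_all add: insert_commute)
    ultimately show False
      using none unfolding u_def by (simp add: mlcm_mdvd_iff) blast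
  qed
  have "cut_sum C u (d c) = 0"
    using c(1) zero by (subst taylor_diff_superset[OF finite_scarf_edges]) (simp_all add: cut_sum_sum)
  moreover obtain s where s: "lookup s 0 \<noteq> 0" "cut_sum C u (scal 1 (bd {x, y})) =
      (if mdvd (mlcm {x, y}) u then (of_bool (x \<in> C) - of_bool (y \<in> C)) * lookup (1 * s) (u - mlcm {x, y}) else 0)"
    using cut_sum_edge[OF xy(2,3) \<open>x \<noteq> y\<close>] by metis
  \<comment> \<open>At \<open>u\<close> equal to the lcm the value is the constant coefficient of
    \<open>s\<close>, which is nonzero.\<close>
  then have "cut_sum C u (scal 1 (bd {x, y})) \<noteq> 0"
    using xy(1,4) by (simp add: u_def)
  ultimately show False using c(2) by simp
qed

text \<open>All vertices are moved to the common degree \<open>B\<close>, where connected vertices become homologous.\<close>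

lemma join_tree_of_scarf_resolves:
  assumes scarf_resolves and dim: "\<And>\<sigma>. \<sigma> \<in> scarf_complex I \<Longrightarrow> card \<sigma> \<le> 2"
  shows "join_tree between (mingens I) (scarf_edges I)"
proof -
  note B1 = scarf_complex_1[unfolded One_nat_def] and B2 = scarf_complex_2
    and B3 = scarf_complex_higher[OF dim]
  have ker: "d ` free_on {\<sigma> \<in> scarf_complex I. card \<sigma> = Suc (Suc i)} =
      {c \<in> free_on {\<sigma> \<in> scarf_complex I. card \<sigma> = Suc i}. d c = 0}" for i
    using assms(1) unfolding minimal_free_resolution_def free_resolution_def by blast
  have exact: "d ` free_on (scarf_edges I) = {c \<in> free_on ((\<lambda>m. {m}) ` mingens I). d c = 0}"
    using ker[of 0] by (simp add: B1 B2)
  \<comment> \<open>There are no Scarf faces with three elements, so exactness at the edges says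
    that the kernel is zero.\<close>
  have inj: "c = 0" if "c \<in> free_on (scarf_edges I)" "d c = 0" for c
    using ker[of 1] that by (auto simp: B2 B3 taylor_diff_zero)
  note cut = scarf_cut[OF exact]
  have "\<exists>T0\<subseteq>scarf_edges I. join_tree (\<lambda>_ _ _. True) (mingens I) T0"
  proof (rule spanning_tree_of_cuts[OF finite_mingens nonzero])
    show "e \<subseteq> mingens I" if "e \<in> scarf_edges I" for e using that by (rule scarf_edgeE) simp
  qed (use cut in blast)
  then obtain T0 where T0: "T0 \<subseteq> scarf_edges I" "join_tree (\<lambda>_ _ _. True) (mingens I) T0" by blast
  define B where "B = mlcm (mingens I)"
  define g where "g m = single {m} (mono_poly (B - m) :: ('v, 'k) mpoly)" for m
  have edge: "\<exists>q. q \<noteq> 0 \<and> d (single {x, y} q) = g x - g y"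
    if xy: "x \<in> mingens I" "y \<in> mingens I" "x \<noteq> y" for x y
  proof -
    obtain s where s: "s * s = 1"
      "bd {x, y} = scal s (single {x} (mono_poly (mlcm {x, y} - x)) - single {y} (mono_poly (mlcm {x, y} - y)))"
      using bd_edge[OF xy] by metis
    define t where "t = B - mlcm {x, y}"
    \<comment> \<open>\<open>t\<close> lifts the lcm of the edge to the common degree
      \<open>B\<close>, and the two factors \<open>s\<close> cancel.\<close>
    have t: "mono_poly t * s * (s * mono_poly (mlcm {x, y} - z)) = (mono_poly (B - z) :: ('v, 'k) mpoly)"
      if "z \<in> {x, y}" for z
    proof -
      have "mdvd (mlcm {x, y}) B" "mdvd z (mlcm {x, y})"
        using xy that finite_mingens unfolding B_def by (auto simp: mlcm_mdvd_iff intro: mdvd_mlcm)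
      then have "t + (mlcm {x, y} - z) = B - z"
        by (intro poly_mapping_eqI) (simp add: t_def lookup_add lookup_minus mdvd_def)
      moreover have "mono_poly t * s * (s * mono_poly (mlcm {x, y} - z)) =
          (s * s) * (mono_poly t * mono_poly (mlcm {x, y} - z))"
        by (simp only: ac_simps)
      ultimately show ?thesis by (simp add: s(1) mono_poly_mult)
    qed
    have "d (single {x, y} (mono_poly t * s)) = g x - g y"
      by (simp add: taylor_diff_single s(2) scal_scal scal_diff scal_single g_def t)
    moreover have "mono_poly t * s \<noteq> 0"
    proof
      assume "mono_poly t * s = 0"
      then have "mono_poly t * s * s = 0" by simp
      then have "mono_poly t = (0 :: ('v, 'k) mpoly)" using s(1) by (simp add: mult.assoc)
      then show False by (metis lookup_single_eq lookup_zero mono_poly_def zero_neq_one)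
    qed
    ultimately show ?thesis by blast
  qed
  have homologous: "g x - g y \<in> d ` free_on T"
    if "join_tree (\<lambda>_ _ _. True) F T" "F \<subseteq> mingens I" "x \<in> F" "y \<in> F" for F T x y
    using that
  proof (induction arbitrary: x y rule: join_tree.induct)
    case (single m)
    then show ?case by (simp add: taylor_diff_zero)
  next
    case (leaf F T m p)
    let ?im = "d ` free_on (insert {m, p} T)"
    have diff: "a - b \<in> ?im" if "a \<in> ?im" "b \<in> ?im" for a b
      using that by (auto simp: taylor_diff_diff[symmetric] intro!: imageI free_on_diff)
    obtain q where "d (single {m, p} q) = g m - g p"
      using edge[of m p] leaf.prems(1) leaf.hyps(2,3) by blast
    then have "g m - g p \<in> ?im" by (metis free_on_single imageI insertI1)
    moreover have "g z - g p \<in> ?im" if "z \<in> F" for z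
      using leaf.IH[of z p] leaf.prems(1) leaf.hyps(3) that free_on_mono[of T "insert {m, p} T"] by blast
    ultimately have base: "g z - g p \<in> ?im" if "z \<in> insert m F" for z using that by blast
    have "(g x - g p) - (g y - g p) \<in> ?im"
      by (rule diff[OF base[OF leaf.prems(2)] base[OF leaf.prems(3)]])
    then show ?case by simp
  qed
  \<comment> \<open>An edge outside the spanning tree closes a cycle: \<open>g x - g y\<close> would
    have one preimage using that edge and another supported on \<open>T0\<close>, against
    injectivity.\<close>
  have "scarf_edges I = T0"
  proof (rule ccontr)
    assume "scarf_edges I \<noteq> T0"
    then obtain e where e: "e \<in> scarf_edges I" "e \<notin> T0" using T0(1) by blast
    obtain x y where xy: "x \<in> mingens I" "y \<in> mingens I" "x \<noteq> y" "e = {x, y}"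
      using e(1) by (rule scarf_edgeE)
    obtain q where q: "q \<noteq> 0" "d (single e q) = g x - g y" using edge[OF xy(1-3)] xy(4) by blast
    obtain c where c: "c \<in> free_on T0" "d c = g x - g y"
      using homologous[OF T0(2) order_refl xy(1,2)] by (metis imageE)
    have "single e q - c = 0"
    proof (rule inj)
      show "single e q - c \<in> free_on (scarf_edges I)"
        by (rule free_on_diff[OF free_on_single[OF e(1)] free_on_mono[OF T0(1) c(1)]])
      show "d (single e q - c) = 0" by (simp add: taylor_diff_diff q(2) c(2))
    qed
    then show False using q(1) free_on_lookup[OF c(1) e(2)] by (metis lookup_single_eq right_minus_eq)
  qed
  then have "join_tree (\<lambda>_ _ _. True) (mingens I) (scarf_edges I)" using T0(2) by simp
  then show ?thesis by (rule join_tree_of_cuts) (rule cut)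
qed

end

section \<open>The criterion for monomial ideals with Scarf complex of dimension at most one\<close>

theorem scarf_ideal_iff_join_tree:
  fixes I :: "('v::finite, 'k::field) mpoly set"
  assumes "finite (mingens I)" and "ideal_gen (mono_poly ` mingens I) = I"
    and "0 \<notin> mingens I" and "mingens I \<noteq> {}"
    and dim: "\<And>\<sigma>. \<sigma> \<in> scarf_complex I \<Longrightarrow> card \<sigma> \<le> 2"
  shows "scarf_ideal I \<longleftrightarrow>
    (\<exists>T. join_tree between (mingens I) T) \<and> card (mingens I) - 1 \<le> card (scarf_edges I)"
proof -
  have mi: "monomial_ideal I ms" if "distinct ms" "set ms = mingens I" for ms
    using that assms by unfold_locales
  show ?thesis
  proof
    assume "scarf_ideal I"
    then obtain ms where ms: "distinct ms" "set ms = mingens I"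
      and "minimal_free_resolution (\<lambda>i. {\<sigma> \<in> scarf_complex I. card \<sigma> = i}) (taylor_diff ms) (\<lambda>c. lookup c {}) I"
      unfolding scarf_ideal_def by blast
    then have tree: "join_tree between (mingens I) (scarf_edges I)"
      using monomial_ideal.join_tree_of_scarf_resolves[OF mi[OF ms]] dim by blast
    then show "(\<exists>T. join_tree between (mingens I) T) \<and> card (mingens I) - 1 \<le> card (scarf_edges I)"
      using join_tree_card[OF tree] by auto
  next
    assume rhs: "(\<exists>T. join_tree between (mingens I) T) \<and> card (mingens I) - 1 \<le> card (scarf_edges I)"
    obtain ms where ms: "distinct ms" "set ms = mingens I"
      using finite_distinct_list[OF assms(1)] by blast
    then show "scarf_ideal I"
      unfolding scarf_ideal_def
      using monomial_ideal.scarf_resolves_of_join_tree[OF mi[OF ms]] dim rhs by blast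
  qed
qed


section \<open>Cover ideals\<close>

definition squarefree_mono :: "'v::finite set \<Rightarrow> 'v monom" where
  "squarefree_mono W = (\<Sum>x\<in>W. single x 1)"

lemma lookup_squarefree_mono: "lookup (squarefree_mono W) v = of_bool (v \<in> W)"
  by (simp add: squarefree_mono_def lookup_sum lookup_single when_def)

lemma keys_squarefree_mono [simp]: "keys (squarefree_mono W) = W"
  by (auto simp: in_keys_iff lookup_squarefree_mono)

lemma inj_squarefree_mono: "inj_on squarefree_mono A"
  by (metis inj_onI keys_squarefree_mono)

lemma mdvd_squarefree_mono: "mdvd (squarefree_mono U) (squarefree_mono W) \<longleftrightarrow> U \<subseteq> W"
  by (auto simp: mdvd_def lookup_squarefree_mono of_bool_def split: if_splits)

lemma mlcm_squarefree_mono: "mlcm (squarefree_mono ` \<W>) = squarefree_mono (\<Union>\<W>)"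
  by (intro mdvd_antisym)
    (auto simp: mlcm_mdvd_iff mdvd_squarefree_mono mdvd_def lookup_squarefree_mono of_bool_def
      lookup_mlcm Max_ge_iff split: if_splits)

lemma between_squarefree_mono:
  "between (squarefree_mono P) (squarefree_mono V) (squarefree_mono W) \<longleftrightarrow> P \<subseteq> V \<union> W"
  using mlcm_squarefree_mono[of "{V, W}"] by (simp add: mdvd_squarefree_mono)

lemma prod_Var: "(\<Prod>x\<in>W. Var x) = (mono_poly (squarefree_mono W) :: ('v::finite, 'k::field) mpoly)"
proof (induction W rule: infinite_finite_induct)
  case (insert x W)
  then show ?case by (simp add: squarefree_mono_def Var_def mono_poly_mult)
qed (simp_all add: squarefree_mono_def mono_poly_def)

lemma cover_ideal_eq: "cover_ideal E = ideal_gen (mono_poly ` squarefree_mono ` {W. vertex_cover E W})"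
  unfolding cover_ideal_def by (rule arg_cong[where f = ideal_gen]) (auto simp: prod_Var)

lemma vertex_cover_minimal_subset:
  fixes W :: "'v::finite set"
  assumes "vertex_cover E W"
  shows "\<exists>U\<subseteq>W. minimal_vertex_cover E U"
proof -
  obtain U where "U \<subseteq> W" "U \<in> {U. vertex_cover E U}" "\<forall>V\<in>{U. vertex_cover E U}. V \<subseteq> U \<longrightarrow> U = V"
    using finite_has_minimal2[of "{U. vertex_cover E U}" W] assms by auto
  then show ?thesis unfolding minimal_vertex_cover_def by blast
qed

lemma mingens_cover_ideal:
  "mingens (cover_ideal E :: ('v::finite, 'k::field) mpoly set) = squarefree_mono ` {W. minimal_vertex_cover E W}"
proof -
  have in_ideal: "(mono_poly t :: ('v, 'k) mpoly) \<in> cover_ideal E \<longleftrightarrow>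
      (\<exists>W. vertex_cover E W \<and> mdvd (squarefree_mono W) t)" for t
    unfolding cover_ideal_eq mono_poly_in_ideal_gen_iff by blast
  show ?thesis
  proof (intro set_eqI iffI)
    fix t assume "t \<in> mingens (cover_ideal E :: ('v, 'k) mpoly set)"
    then have t: "(mono_poly t :: ('v, 'k) mpoly) \<in> cover_ideal E"
      and min: "\<And>s. (mono_poly s :: ('v, 'k) mpoly) \<in> cover_ideal E \<Longrightarrow> mdvd s t \<Longrightarrow> s = t"
      by (auto simp: mingens_def)
    obtain W where W: "vertex_cover E W" "mdvd (squarefree_mono W) t"
      using t in_ideal by blast
    obtain U where U: "U \<subseteq> W" "minimal_vertex_cover E U"
      using vertex_cover_minimal_subset[OF W(1)] by blast
    have "mdvd (squarefree_mono U) t"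
      using U(1) by (intro mdvd_trans[OF _ W(2)]) (simp add: mdvd_squarefree_mono)
    moreover have "(mono_poly (squarefree_mono U) :: ('v, 'k) mpoly) \<in> cover_ideal E"
      using U(2) in_ideal mdvd_refl unfolding minimal_vertex_cover_def by blast
    ultimately have "squarefree_mono U = t" by (intro min)
    then show "t \<in> squarefree_mono ` {W. minimal_vertex_cover E W}" using U(2) by blast
  next
    fix t :: "'v monom" assume "t \<in> squarefree_mono ` {W. minimal_vertex_cover E W}"
    then obtain W where W: "minimal_vertex_cover E W" "t = squarefree_mono W" by blast
    have "s = t" if s: "(mono_poly s :: ('v, 'k) mpoly) \<in> cover_ideal E" "mdvd s t" for s
    proof -
      obtain U where U: "vertex_cover E U" "mdvd (squarefree_mono U) s"
        using s(1) in_ideal by blast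
      then have "U \<subseteq> W" using mdvd_trans[OF U(2) s(2)] by (simp add: W(2) mdvd_squarefree_mono)
      then have "U = W" using W(1) U(1) unfolding minimal_vertex_cover_def by blast
      then show ?thesis using U(2) s(2) W(2) mdvd_antisym by blast
    qed
    moreover have "(mono_poly t :: ('v, 'k) mpoly) \<in> cover_ideal E"
      using W in_ideal mdvd_refl unfolding minimal_vertex_cover_def by blast
    ultimately show "t \<in> mingens (cover_ideal E :: ('v, 'k) mpoly set)"
      by (simp add: mingens_def)
  qed
qed

text \<open>
  Among three vertex covers, the vertices lying in at least two of them again form a vertex cover,
  so any three minimal generators make some minimal generator redundant.
\<close>

lemma scarf_complex_cover_ideal_dim:
  fixes E :: "'v::finite set set"
  assumes "simple_graph E"
    and \<sigma>: "\<sigma> \<in> scarf_complex (cover_ideal E :: ('v, 'k::field) mpoly set)"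
  shows "card \<sigma> \<le> 2"
proof (rule ccontr)
  let ?I = "cover_ideal E :: ('v, 'k) mpoly set"
  assume "\<not> card \<sigma> \<le> 2"
  have sub: "\<sigma> \<subseteq> mingens ?I" using \<sigma> by (simp add: scarf_complex_def)
  then obtain \<W> where W: "\<W> \<subseteq> {W. minimal_vertex_cover E W}" "\<sigma> = squarefree_mono ` \<W>"
    unfolding mingens_cover_ideal by (meson subset_imageE)
  \<comment> \<open>Uniqueness of the lcm, translated to covers: no other family of minimal covers
    has the same union.\<close>
  have absorb: "\<V> = \<W>" if "\<V> \<subseteq> {W. minimal_vertex_cover E W}" "\<Union>\<V> = \<Union>\<W>" for \<V>
  proof -
    have "squarefree_mono ` \<V> \<subseteq> mingens ?I" using that(1) by (auto simp: mingens_cover_ideal)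
    moreover have "mlcm (squarefree_mono ` \<V>) = mlcm \<sigma>"
      by (simp add: W(2) mlcm_squarefree_mono that(2))
    ultimately have "squarefree_mono ` \<V> = squarefree_mono ` \<W>"
      using scarf_complexD[OF \<sigma>] W(2) by simp
    then show ?thesis using inj_squarefree_mono[of UNIV] by (metis inj_image_eq_iff)
  qed
  have "card \<W> = card \<sigma>" by (simp add: W(2) card_image inj_squarefree_mono)
  then have "Suc (Suc (Suc 0)) \<le> card \<W>" using \<open>\<not> card \<sigma> \<le> 2\<close> by simp
  then obtain A B C where ABC: "A \<in> \<W>" "B \<in> \<W>" "C \<in> \<W>" "A \<noteq> B" "A \<noteq> C" "B \<noteq> C"
    by (auto simp: card_le_Suc_iff)
  define Maj where "Maj = A \<inter> B \<union> A \<inter> C \<union> B \<inter> C"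
  have covers: "vertex_cover E A" "vertex_cover E B" "vertex_cover E C"
    using ABC(1-3) W(1) by (auto simp: minimal_vertex_cover_def)
  \<comment> \<open>Pigeonhole: each of three covers contains an end of \<open>e\<close>, and
    \<open>e\<close> has only two ends.\<close>
  have "vertex_cover E Maj"
    unfolding vertex_cover_def
  proof
    fix e assume e: "e \<in> E"
    then obtain u v where uv: "e = {u, v}" using assms(1) by (auto simp: simple_graph_def card_2_iff)
    have "e \<inter> A \<noteq> {}" "e \<inter> B \<noteq> {}" "e \<inter> C \<noteq> {}"
      using covers e by (simp_all add: vertex_cover_def)
    then show "e \<inter> Maj \<noteq> {}"
      unfolding Maj_def uv by auto
  qed
  then obtain U where U: "U \<subseteq> Maj" "minimal_vertex_cover E U"
    using vertex_cover_minimal_subset by blast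
  have "U \<subseteq> \<Union>\<W>" using U(1) ABC(1-3) by (auto simp: Maj_def)
  then have "insert U \<W> = \<W>" using U(2) W(1) by (intro absorb) auto
  moreover have "U \<subseteq> \<Union>(\<W> - {U})"
  proof
    fix v assume "v \<in> U"
    then consider "v \<in> A" "v \<in> B" | "v \<in> A" "v \<in> C" | "v \<in> B" "v \<in> C"
      using U(1) by (auto simp: Maj_def)
    then show "v \<in> \<Union>(\<W> - {U})"
    proof cases
      case 1
      then show ?thesis using ABC(1,2,4) by (cases "A = U") auto
    next
      case 2
      then show ?thesis using ABC(1,3,5) by (cases "A = U") auto
    next
      case 3
      then show ?thesis using ABC(2,3,6) by (cases "B = U") auto
    qed
  qed
  then have "\<Union>(\<W> - {U}) = \<Union>\<W>" by blast
  then have "\<W> - {U} = \<W>" using W(1) by (intro absorb) auto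
  ultimately show False by blast
qed

section \<open>Minimal vertex covers, cliques of the complement graph, and the main
  equivalence\<close>

definition neighbour_pairs :: "'v set set \<Rightarrow> 'v set set set" where
  "neighbour_pairs E = {{V1, V2} | V1 V2. V1 \<noteq> V2 \<and> minimal_vertex_cover E V1 \<and> minimal_vertex_cover E V2 \<and>
    {U. minimal_vertex_cover E U \<and> U \<subseteq> V1 \<union> V2} = {V1, V2}}"

lemma complement_graph_iff: "{u, v} \<in> complement_graph E \<longleftrightarrow> u \<noteq> v \<and> {u, v} \<notin> E"
  by (auto simp: complement_graph_def doubleton_eq_iff insert_commute)

lemma vertex_cover_iff_clique:
  assumes "simple_graph E"
  shows "vertex_cover E W \<longleftrightarrow> clique (complement_graph E) (- W)"
proof
  assume cover: "vertex_cover E W"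
  show "clique (complement_graph E) (- W)"
    unfolding clique_def complement_graph_iff
  proof (intro ballI impI conjI notI)
    fix u v assume "u \<in> - W" "v \<in> - W" "{u, v} \<in> E"
    then show False using cover[unfolded vertex_cover_def, THEN bspec, of "{u, v}"] by simp
  qed simp
next
  assume clique: "clique (complement_graph E) (- W)"
  show "vertex_cover E W"
    unfolding vertex_cover_def
  proof
    fix e assume e: "e \<in> E"
    then obtain u v where "e = {u, v}" "u \<noteq> v"
      using assms by (auto simp: simple_graph_def card_2_iff)
    then show "e \<inter> W \<noteq> {}"
      using cliqueD[OF clique, of u v] e by (auto simp: complement_graph_iff)
  qed
qed

lemma vertex_cover_mono: "vertex_cover E U \<Longrightarrow> U \<subseteq> W \<Longrightarrow> vertex_cover E W"
  unfolding vertex_cover_def by blast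

text \<open>Complementation reverses inclusion and turns deleting \<open>v\<close> from a cover into
  adding \<open>v\<close> to a clique.\<close>

lemma max_cliques_complement:
  assumes "simple_graph E"
  shows "max_cliques (complement_graph E) UNIV = uminus ` {W. minimal_vertex_cover E W}"
proof -
  let ?H = "complement_graph E"
  have iff: "minimal_vertex_cover E W \<longleftrightarrow> - W \<in> max_cliques ?H UNIV" for W
  proof
    assume W: "minimal_vertex_cover E W"
    have "\<not> clique ?H (insert v (- W))" if "v \<in> W" for v
    proof -
      have "insert v (- W) = - (W - {v})" by auto
      moreover have "\<not> vertex_cover E (W - {v})"
        using W that unfolding minimal_vertex_cover_def by blast
      ultimately show ?thesis by (simp add: vertex_cover_iff_clique[OF assms])
    qed
    then show "- W \<in> max_cliques ?H UNIV"
      using W by (auto simp: max_cliques_def minimal_vertex_cover_def vertex_cover_iff_clique[OF assms])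
  next
    assume W: "- W \<in> max_cliques ?H UNIV"
    have "\<not> vertex_cover E U" if sub: "U \<subset> W" for U
    proof
      assume U: "vertex_cover E U"
      obtain v where v: "v \<in> W" "v \<notin> U" using sub by blast
      then have "vertex_cover E (W - {v})" using sub by (intro vertex_cover_mono[OF U]) auto
      moreover have "- (W - {v}) = insert v (- W)" by auto
      ultimately have "clique ?H (insert v (- W))" by (simp add: vertex_cover_iff_clique[OF assms])
      then show False using W v by (auto simp: max_cliques_def)
    qed
    then show "minimal_vertex_cover E W"
      using W by (auto simp: max_cliques_def minimal_vertex_cover_def vertex_cover_iff_clique[OF assms])
  qed
  show ?thesis
  proof (intro set_eqI iffI)
    fix K assume "K \<in> max_cliques ?H UNIV"
    then have "minimal_vertex_cover E (- K)" by (simp add: iff)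
    then show "K \<in> uminus ` {W. minimal_vertex_cover E W}" by (intro image_eqI[of _ _ "- K"]) auto
  qed (auto simp: iff)
qed

text \<open>By De Morgan, \<open>K \<inter> L \<subseteq> P\<close> says that the complement of
  \<open>P\<close> lies in the union of the complements of \<open>K\<close> and \<open>L\<close>,
  which for squarefree monomials is \<open>between\<close>. Complementing nodes thus translates
  clique trees and join trees into each other.\<close>

lemma co_chordal_iff_join_tree:
  fixes E :: "'v::finite set set"
  assumes "simple_graph E"
  shows "co_chordal E \<longleftrightarrow> (\<exists>T. join_tree between (squarefree_mono ` {W. minimal_vertex_cover E W}) T)"
proof -
  let ?H = "complement_graph E" and ?W = "{W. minimal_vertex_cover E W}"
  have loopless: "{v} \<notin> ?H" for v by (auto simp: complement_graph_def doubleton_eq_iff)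
  note cliques = max_cliques_complement[OF assms]
  show ?thesis
  proof
    assume "co_chordal E"
    then obtain T where T: "clique_tree (max_cliques ?H UNIV) T"
      using clique_tree_of_chordal[OF loopless, of UNIV] by (auto simp: co_chordal_def)
    let ?g = "\<lambda>K. squarefree_mono (- K)"
    have "join_tree between (?g ` max_cliques ?H UNIV) ((`) ?g ` T)"
    proof (rule join_tree_image[OF T])
      show "inj_on ?g (max_cliques ?H UNIV)"
        by (rule inj_onI) (metis double_complement keys_squarefree_mono)
    qed (auto simp: between_squarefree_mono)
    moreover have "?g ` max_cliques ?H UNIV = squarefree_mono ` ?W"
      by (simp add: cliques image_image)
    ultimately show "\<exists>T. join_tree between (squarefree_mono ` ?W) T" by auto
  next
    assume "\<exists>T. join_tree between (squarefree_mono ` ?W) T"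
    then obtain T where T: "join_tree between (squarefree_mono ` ?W) T" by blast
    let ?g = "\<lambda>t :: 'v monom. - keys t"
    have "clique_tree (?g ` squarefree_mono ` ?W) ((`) ?g ` T)"
    proof (rule join_tree_image[OF T])
      show "inj_on ?g (squarefree_mono ` ?W)" by (auto simp: inj_on_def)
    qed (auto simp: between_squarefree_mono)
    moreover have "?g ` squarefree_mono ` ?W = max_cliques ?H UNIV"
      by (simp add: cliques image_image)
    ultimately show "co_chordal E"
      using chordal_of_clique_tree[OF loopless] by (auto simp: co_chordal_def)
  qed
qed

text \<open>An edge prevents the empty set from being a cover, so 1 is not a generator. Since no
  edge is empty, the set of all vertices is a cover, so generators exist.\<close>

lemma monomial_ideal_cover_ideal:
  fixes E :: "'v::finite set set"
  assumes "E \<noteq> {}" "{} \<notin> E"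
  shows "finite (mingens (cover_ideal E :: ('v, 'k::field) mpoly set))"
    and "ideal_gen (mono_poly ` mingens (cover_ideal E :: ('v, 'k) mpoly set)) = (cover_ideal E :: ('v, 'k) mpoly set)"
    and "0 \<notin> mingens (cover_ideal E :: ('v, 'k) mpoly set)"
    and "mingens (cover_ideal E :: ('v, 'k) mpoly set) \<noteq> {}"
proof -
  show "finite (mingens (cover_ideal E :: ('v, 'k) mpoly set))"
    by (simp add: mingens_cover_ideal)
  show "ideal_gen (mono_poly ` mingens (cover_ideal E :: ('v, 'k) mpoly set)) = (cover_ideal E :: ('v, 'k) mpoly set)"
    by (rule mingens_generate[OF cover_ideal_eq])
  have "\<not> minimal_vertex_cover E {}"
    using assms(1) by (auto simp: minimal_vertex_cover_def vertex_cover_def)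
  moreover have "W = {}" if "squarefree_mono W = 0" for W :: "'v set"
    using keys_squarefree_mono[of W] that by simp
  ultimately show "0 \<notin> mingens (cover_ideal E :: ('v, 'k) mpoly set)"
    unfolding mingens_cover_ideal by (metis imageE mem_Collect_eq)
  have "vertex_cover E UNIV" using assms(2) by (auto simp: vertex_cover_def)
  then show "mingens (cover_ideal E :: ('v, 'k) mpoly set) \<noteq> {}"
    using vertex_cover_minimal_subset[of E UNIV] by (auto simp: mingens_cover_ideal)
qed

text \<open>Taking images under \<open>squarefree_mono\<close> is a bijection from the neighbour
  pairs to the Scarf edges, because the lcm of two generators corresponds to the union of the
  covers.\<close>

lemma card_scarf_edges_cover_ideal:
  fixes E :: "'v::finite set set"
  assumes "E \<noteq> {}" "{} \<notin> E"
  shows "card (scarf_edges (cover_ideal E :: ('v, 'k::field) mpoly set)) = card (neighbour_pairs E)"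
proof -
  let ?I = "cover_ideal E :: ('v, 'k) mpoly set"
  note facts = monomial_ideal_cover_ideal[OF assms, where ?'k = 'k]
  obtain ms where "distinct ms" "set ms = mingens ?I"
    using finite_distinct_list[OF facts(1)] by blast
  then interpret monomial_ideal ?I ms
    using facts by unfold_locales
  have edge: "squarefree_mono ` {V, W} \<in> scarf_edges ?I \<longleftrightarrow>
      {U. minimal_vertex_cover E U \<and> U \<subseteq> V \<union> W} = {V, W}"
    if "minimal_vertex_cover E V" "minimal_vertex_cover E W" "V \<noteq> W" for V W
  proof -
    have "squarefree_mono V \<noteq> squarefree_mono W"
      using that(3) inj_squarefree_mono[of UNIV] by (auto dest: injD)
    then have "squarefree_mono ` {V, W} \<in> scarf_edges ?I \<longleftrightarrow>
        (\<forall>U. minimal_vertex_cover E U \<longrightarrow> U \<subseteq> V \<union> W \<longrightarrow> squarefree_mono U \<in> squarefree_mono ` {V, W})"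
      using that(1,2) scarf_edge_iff[of "squarefree_mono V" "squarefree_mono W"]
      by (simp add: mingens_cover_ideal between_squarefree_mono)
    also have "\<dots> \<longleftrightarrow> (\<forall>U. minimal_vertex_cover E U \<longrightarrow> U \<subseteq> V \<union> W \<longrightarrow> U \<in> {V, W})"
      by (simp only: inj_image_mem_iff[OF inj_squarefree_mono])
    also have "\<dots> \<longleftrightarrow> {U. minimal_vertex_cover E U \<and> U \<subseteq> V \<union> W} = {V, W}"
      using that(1,2) by blast
    finally show ?thesis .
  qed
  have "scarf_edges ?I = (`) squarefree_mono ` neighbour_pairs E"
  proof (intro set_eqI iffI)
    fix e assume e: "e \<in> scarf_edges ?I"
    then obtain x y where "x \<in> mingens ?I" "y \<in> mingens ?I" "x \<noteq> y" "e = {x, y}"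
      by (rule scarf_edgeE)
    then obtain V W where VW: "minimal_vertex_cover E V" "minimal_vertex_cover E W" "V \<noteq> W"
      "e = squarefree_mono ` {V, W}"
      unfolding mingens_cover_ideal by auto
    then have "{V, W} \<in> neighbour_pairs E"
      using e edge[OF VW(1-3)] unfolding neighbour_pairs_def by blast
    then show "e \<in> (`) squarefree_mono ` neighbour_pairs E" using VW(4) by blast
  next
    fix e assume "e \<in> (`) squarefree_mono ` neighbour_pairs E"
    then show "e \<in> scarf_edges ?I"
      unfolding neighbour_pairs_def using edge by blast
  qed
  moreover have "inj_on ((`) squarefree_mono) (neighbour_pairs E)"
    by (rule inj_onI) (metis inj_image_eq_iff inj_squarefree_mono)
  ultimately show ?thesis by (simp add: card_image)
qed

theorem theorem1p3:
  fixes E :: "'v::finite set set" and n :: nat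
  assumes "simple_graph E"
    and "E \<noteq> {}"
    and "no_isolated_vertices E"
    and "n = card {W. minimal_vertex_cover E W}"
  shows "scarf_ideal (cover_ideal E :: ('v, 'k::field) mpoly set) \<longleftrightarrow>
    co_chordal E \<and>
    card {{V1, V2} | V1 V2. V1 \<noteq> V2 \<and> minimal_vertex_cover E V1 \<and> minimal_vertex_cover E V2 \<and>
        {U. minimal_vertex_cover E U \<and> U \<subseteq> V1 \<union> V2} = {V1, V2}} \<ge> n - 1"
proof -
  let ?I = "cover_ideal E :: ('v, 'k) mpoly set"
  have "{} \<notin> E" using assms(1) by (auto simp: simple_graph_def)
  note ideal = monomial_ideal_cover_ideal[OF assms(2) this, where ?'k = 'k]
    and pairs = card_scarf_edges_cover_ideal[OF assms(2) this, where ?'k = 'k]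
  have "card (mingens ?I) = n"
    by (simp add: mingens_cover_ideal assms(4) card_image inj_squarefree_mono)
  then have "scarf_ideal ?I \<longleftrightarrow> co_chordal E \<and> n - 1 \<le> card (neighbour_pairs E)"
    using scarf_ideal_iff_join_tree[OF ideal scarf_complex_cover_ideal_dim[OF assms(1)]]
    by (simp add: mingens_cover_ideal co_chordal_iff_join_tree[OF assms(1)] pairs)
  then show ?thesis by (simp only: neighbour_pairs_def)
qed

end
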